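(* For each $n \in \mathbb{N}$ let $$T_n(t) = \sum_{j=0}^{n} a_{j,n} \cos(jt),$$ where the set $$S := \{a_{j,n}: j=0,1,\ldots,n,\ n \in \mathbb{N}\} \subset [0,\infty)$$ is finite. If $$\lim_{n \to \infty} \mathrm{NC}(T_n) = \infty,$$ then $$\lim_{n \to \infty} \mathrm{NZ}(T_n) = \infty.$$
   Context: $\mathbb{N}=\{1,2,3,\ldots\}$. For $T_n(t) = \sum_{j=0}^n a_{j,n}\cos(jt)$, $\mathrm{NC}(T_n) := |\{j \in \{0,1,\ldots,n\}: a_{j,n} \neq 0\}|$ is the number of nonzero coefficients, and $\mathrm{NZ}(T_n)$ denotes the number of real zeros of $T_n$, counted with multiplicities, in a period $[a,a+2\pi)$, $a \in \mathbb{R}$ (with value $\infty$ if $T_n\equiv 0$). *)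

theory Defs
  imports "HOL-Analysis.Analysis"
begin

definition cos_poly :: "(nat \<Rightarrow> real) \<Rightarrow> nat \<Rightarrow> real \<Rightarrow> real" where
  "cos_poly c n t = (\<Sum>j=0..n. c j * cos (real j * t))"

definition NC :: "(nat \<Rightarrow> real) \<Rightarrow> nat \<Rightarrow> nat" where
  "NC c n = card {j \<in> {0..n}. c j \<noteq> 0}"

text \<open>
  Order of the first derivative of a smooth \<open>f\<close> that does not vanish at \<open>t\<close>;
  it is \<open>\<infinity>\<close> (the infimum of the empty set) if all derivatives vanish at \<open>t\<close>.
\<close>
definition zero_multiplicity :: "(real \<Rightarrow> real) \<Rightarrow> real \<Rightarrow> enat" where
  "zero_multiplicity f t = Inf (enat ` {k. (deriv ^^ k) f t \<noteq> 0})"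

text \<open>
  The number of zeros, with multiplicity, in the period \<open>[s, s + 2\<pi>)\<close>. Infinite zero sets,
  in particular that of \<open>f = 0\<close>, are treated separately because \<open>sum\<close> over an infinite set is \<open>0\<close>.
\<close>
definition NZ :: "real \<Rightarrow> (real \<Rightarrow> real) \<Rightarrow> enat" where
  "NZ s f =
    (let Z = {t \<in> {s..<s + 2 * pi}. f t = 0}
     in if finite Z then (\<Sum>t\<in>Z. zero_multiplicity f t) else \<infinity>)"

end

theory Submission
  imports Defs "HOL-Complex_Analysis.Great_Picard"
begin

text \<open>
  Let \<open>T\<close> be a cosine polynomial with coefficients in the finite set and at most \<open>k\<close> zeros in \<open>(0, \<pi>)\<close>.
  A product \<open>Q\<close> of \<open>k\<close> factors \<open>2 cos y - 2 cos t\<close>, up to sign, makes \<open>T Q\<close> nonnegative, so the \<open>L\<^sup>1\<close> norm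
  of \<open>T Q\<close> is a multiple of its constant coefficient and hence bounded. A weak form of
  Littlewood's conjecture (few coefficients of a function with bounded \<open>L\<^sup>1\<close> norm are bounded
  away from \<open>0\<close>), proved by the method of Cohen and Davenport, then bounds the number of nonzero
  coefficients of \<open>T Q\<close>. As \<open>Q\<close> varies with \<open>T\<close>, one passes to a limit of the polynomials \<open>Q\<close> along a
  sequence of counterexamples: then the coefficients of the products \<open>T Q\<close> are close to a fixed
  finite set, and the weak Littlewood theorem tolerates the error.

  Outside boundedly many places the coefficients of \<open>T\<close> thus satisfy a fixed linear recurrence,
  and being finite-valued they are periodic there, with a fixed period \<open>P\<close>. Hence
  \<open>sin (P t / 2) T(t)\<close> is a sum of boundedly many sines. This bounds the integrals of \<open>T\<close> over all
  intervals near \<open>0\<close>, and as \<open>T\<close> has few sign changes also the integral of \<open>\<bar>T\<bar>\<close> there. Multiplying by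
  \<open>1 + e\<^sup>i\<^sup>t + \<dots> + e\<^sup>i\<^sup>(\<^sup>P\<^sup>-\<^sup>1\<^sup>)\<^sup>t\<close> removes the other poles of \<open>1 / sin (P t / 2)\<close> and gives a function with bounded
  \<open>L\<^sup>1\<close> norm. Its coefficients are sums of \<open>P\<close> consecutive coefficients of \<open>T\<close>; as there is no
  cancellation between nonnegative numbers, the weak Littlewood theorem bounds \<open>NC(T)\<close>.
\<close>

section \<open>Trigonometric polynomials and their coefficients\<close>

definition trig :: "int set \<Rightarrow> (int \<Rightarrow> complex) \<Rightarrow> real \<Rightarrow> complex" where
  "trig J c t = (\<Sum>j\<in>J. c j * cis (of_int j * t))"

lemma continuous_on_trig [continuous_intros]: "continuous_on S (trig J c)"
  unfolding trig_def by (intro continuous_intros)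

text \<open>Convolution of coefficients. As \<open>b\<close> vanishes off \<open>J\<close>, the
  product may be written over any finite \<open>K\<close> containing all sums \<open>i + j\<close>;
  the extra frequencies carry coefficient 0.\<close>

lemma trig_mult:
  assumes "finite I" "finite K" and K: "\<And>i j. i \<in> I \<Longrightarrow> j \<in> J \<Longrightarrow> i + j \<in> K"
    and b: "\<And>j. j \<notin> J \<Longrightarrow> b j = 0"
  shows "trig I q t * trig J b t = trig K (\<lambda>m. \<Sum>i\<in>I. q i * b (m - i)) t"
proof -
  have inner: "(\<Sum>m\<in>K. b (m - i) * cis (of_int m * t)) = cis (of_int i * t) * trig J b t" if "i \<in> I" for i
  proof -
    have "(\<Sum>m\<in>K. b (m - i) * cis (of_int m * t)) = (\<Sum>m\<in>(+) i ` J. b (m - i) * cis (of_int m * t))"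
    proof (rule sum.mono_neutral_right[OF \<open>finite K\<close>])
      show "(+) i ` J \<subseteq> K" using K that by auto
      show "\<forall>m\<in>K - (+) i ` J. b (m - i) * cis (of_int m * t) = 0"
      proof
        fix m assume "m \<in> K - (+) i ` J"
        then have "m - i \<notin> J" by force
        then show "b (m - i) * cis (of_int m * t) = 0" using b by simp
      qed
    qed
    also have "\<dots> = (\<Sum>j\<in>J. b j * cis (of_int (i + j) * t))"
      by (subst sum.reindex) (auto simp: inj_on_def)
    also have "\<dots> = cis (of_int i * t) * trig J b t"
      unfolding trig_def sum_distrib_left
      by (intro sum.cong refl) (simp add: cis_mult[symmetric] algebra_simps)
    finally show ?thesis .
  qed
  have "trig K (\<lambda>m. \<Sum>i\<in>I. q i * b (m - i)) t
      = (\<Sum>m\<in>K. \<Sum>i\<in>I. q i * (b (m - i) * cis (of_int m * t)))"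
    unfolding trig_def by (simp add: sum_distrib_right mult.assoc)
  also have "\<dots> = (\<Sum>i\<in>I. q i * (\<Sum>m\<in>K. b (m - i) * cis (of_int m * t)))"
    by (subst sum.swap) (simp add: sum_distrib_left)
  also have "\<dots> = (\<Sum>i\<in>I. q i * cis (of_int i * t) * trig J b t)"
    by (intro sum.cong refl) (simp add: inner mult.assoc)
  also have "\<dots> = trig I q t * trig J b t"
    by (simp only: trig_def[of I q] sum_distrib_right)
  finally show ?thesis ..
qed

lemma integral_cis_int:
  "integral {-pi..pi} (\<lambda>t. cis (of_int m * t)) = (if m = 0 then of_real (2 * pi) else 0)"
proof (cases "m = 0")
  case True
  then show ?thesis by (simp add: scaleR_conv_of_real)
next
  case False
  have "((\<lambda>t. cis (of_int m * t)) has_integral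
      (cis (of_int m * pi) / (\<i> * of_int m) - cis (of_int m * (-pi)) / (\<i> * of_int m))) {-pi..pi}"
  proof (rule fundamental_theorem_of_calculus)
    fix x :: real assume "x \<in> {-pi..pi}"
    have "((\<lambda>x. sin (of_int m * x) / of_int m) has_real_derivative cos (of_int m * x)) (at x)"
         "((\<lambda>x. - cos (of_int m * x) / of_int m) has_real_derivative sin (of_int m * x)) (at x)"
      using False by (auto intro!: derivative_eq_intros)
    moreover have "Re (cis (of_int m * x) / (\<i> * of_int m)) = sin (of_int m * x) / of_int m"
      "Im (cis (of_int m * x) / (\<i> * of_int m)) = - cos (of_int m * x) / of_int m" for x
      using False by (simp_all add: Re_divide Im_divide power2_eq_square)
    ultimately have "((\<lambda>x. cis (of_int m * x) / (\<i> * of_int m)) has_vector_derivative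
        cis (of_int m * x)) (at x)"
      by (simp add: has_vector_derivative_complex_iff)
    then show "((\<lambda>x. cis (of_int m * x) / (\<i> * of_int m)) has_vector_derivative
        cis (of_int m * x)) (at x within {-pi..pi})"
      by (rule has_vector_derivative_at_within)
  qed auto
  moreover have "cis (of_int m * pi) = cis (of_int m * (-pi))"
  proof -
    have "cis (of_int m * pi) = cis (of_int m * (-pi)) * cis (2 * pi * of_int m)"
      by (simp add: cis_mult algebra_simps)
    also have "cis (2 * pi * of_int m) = 1" by (simp add: cis_multiple_2pi)
    finally show ?thesis by simp
  qed
  ultimately show ?thesis using False by (simp add: integral_unique)
qed

section \<open>Duality between trigonometric polynomials and test functions\<close>

text \<open>Bilinear, without conjugation: the coefficient at \<open>p\<close> is therefore read off
  by pairing with the exponential of frequency \<open>- p\<close>.\<close>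

definition pairing :: "(real \<Rightarrow> complex) \<Rightarrow> (real \<Rightarrow> complex) \<Rightarrow> complex" where
  "pairing f g = integral {-pi..pi} (\<lambda>t. f t * g t) / of_real (2 * pi)"

lemma pairing_add:
  assumes "continuous_on UNIV f" "continuous_on UNIV g" "continuous_on UNIV h"
  shows "pairing f (\<lambda>t. g t + h t) = pairing f g + pairing f h"
proof -
  have "(\<lambda>t. f t * g t) integrable_on {-pi..pi}" "(\<lambda>t. f t * h t) integrable_on {-pi..pi}"
    using assms by (auto intro!: integrable_continuous_interval continuous_intros
        elim: continuous_on_subset)
  then show ?thesis
    by (simp add: pairing_def ring_distribs integral_add add_divide_distrib)
qed

lemma pairing_cmult: "pairing f (\<lambda>t. a * g t) = a * pairing f g"
proof -
  have "pairing f (\<lambda>t. a * g t) = integral {-pi..pi} (\<lambda>t. a * (f t * g t)) / of_real (2 * pi)"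
    by (simp add: pairing_def mult.left_commute)
  then show ?thesis by (simp add: pairing_def)
qed

lemma pairing_trig_cis:
  assumes "finite J" "\<And>j. j \<notin> J \<Longrightarrow> c j = 0"
  shows "pairing (trig J c) (\<lambda>t. cis (- of_int p * t)) = c p"
proof -
  have "integral {-pi..pi} (\<lambda>t. trig J c t * cis (- of_int p * t))
      = integral {-pi..pi} (\<lambda>t. \<Sum>j\<in>J. c j * cis (of_int (j - p) * t))"
    unfolding trig_def sum_distrib_right
    by (intro integral_cong sum.cong refl) (simp add: cis_mult mult.assoc algebra_simps)
  also have "\<dots> = (\<Sum>j\<in>J. integral {-pi..pi} (\<lambda>t. c j * cis (of_int (j - p) * t)))"
    by (intro integral_sum integrable_continuous_interval continuous_intros assms)
  also have "\<dots> = (\<Sum>j\<in>J. c j * (if j - p = 0 then of_real (2 * pi) else 0))"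
    by (simp only: integral_mult_right integral_cis_int)
  also have "\<dots> = (\<Sum>j\<in>J. if j = p then c j * of_real (2 * pi) else 0)"
    by (intro sum.cong) auto
  also have "\<dots> = c p * of_real (2 * pi)"
    using assms by simp
  finally show ?thesis by (simp add: pairing_def)
qed

lemma norm_pairing_le:
  assumes f: "continuous_on UNIV f" and g: "continuous_on UNIV g" and "\<And>t. norm (g t) \<le> 1"
    and C: "integral {-pi..pi} (\<lambda>t. norm (f t)) \<le> 2 * pi * C"
  shows "norm (pairing f g) \<le> C"
proof -
  have "norm (integral {-pi..pi} (\<lambda>t. f t * g t)) \<le> integral {-pi..pi} (\<lambda>t. norm (f t))"
  proof (rule integral_norm_bound_integral)
    show "(\<lambda>t. f t * g t) integrable_on {-pi..pi}" "(\<lambda>t. norm (f t)) integrable_on {-pi..pi}"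
      using f g by (auto intro!: integrable_continuous_interval continuous_intros
        elim: continuous_on_subset)
    show "norm (f x * g x) \<le> norm (f x)" for x
      using assms(3)[of x] by (simp add: norm_mult mult_left_le)
  qed
  with C show ?thesis by (simp add: pairing_def norm_divide field_simps)
qed

text \<open>
  \<open>tpoly A L \<phi>\<close>: the trigonometric polynomial \<open>\<phi>\<close> has its frequencies in \<open>-A\<close> and coefficients of
  total absolute value at most \<open>L\<close>. The sign is chosen so that pairing with \<open>trig J c\<close> reads off
  the values of \<open>c\<close> on \<open>A\<close>.
\<close>
inductive tpoly :: "int set \<Rightarrow> real \<Rightarrow> (real \<Rightarrow> complex) \<Rightarrow> bool" for A where
  zero: "0 \<le> L \<Longrightarrow> tpoly A L (\<lambda>_. 0)"
| add: "tpoly A L \<phi> \<Longrightarrow> p \<in> A \<Longrightarrow> L + norm a \<le> L' \<Longrightarrow> tpoly A L' (\<lambda>t. \<phi> t + a * cis (- of_int p * t))"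

lemma tpoly_mono:
  assumes "tpoly A L \<phi>" "A \<subseteq> A'" shows "tpoly A' L \<phi>"
  using assms(1)
proof induction
  case (zero L)
  then show ?case by (rule tpoly.zero)
next
  case (add L \<phi> p a L')
  show ?case by (rule tpoly.add[OF add.IH]) (use add assms(2) in blast)+
qed

lemma tpoly_nonneg:
  assumes "tpoly A L \<phi>" shows "0 \<le> L"
  using assms
proof induction
  case (add L \<phi> p a L')
  then show ?case using norm_ge_zero[of a] by linarith
qed

lemma tpoly_weaken:
  assumes "tpoly A L \<phi>" "L \<le> L'" shows "tpoly A L' \<phi>"
  using assms
proof cases
  case zero
  then show ?thesis using assms(2) by (simp add: tpoly.zero)
next
  case (add L1 \<psi> p a)
  show ?thesis unfolding add(1) by (rule tpoly.add[OF add(2)]) (use add assms(2) in linarith)+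
qed

lemma tpoly_monom: "p \<in> A \<Longrightarrow> tpoly A (norm a) (\<lambda>t. a * cis (- of_int p * t))"
  using tpoly.add[OF tpoly.zero[of 0 A], of p a "norm a"] by simp

lemma tpoly_plus:
  assumes \<phi>: "tpoly A L \<phi>" and "tpoly A L' \<psi>"
  shows "tpoly A (L + L') (\<lambda>t. \<phi> t + \<psi> t)"
  using assms(2)
proof induction
  case (zero L')
  then show ?case using tpoly_weaken[OF \<phi>] by simp
next
  case (add L1 \<psi> p a L2)
  have "tpoly A (L + L2) (\<lambda>t. (\<phi> t + \<psi> t) + a * cis (- of_int p * t))"
    by (rule tpoly.add[OF add.IH]) (use add in auto)
  then show ?case by (simp add: add.assoc)
qed

lemma tpoly_sum:
  assumes "finite I" "\<And>i. i \<in> I \<Longrightarrow> tpoly A (L i) (\<phi> i)"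
  shows "tpoly A (\<Sum>i\<in>I. L i) (\<lambda>t. \<Sum>i\<in>I. \<phi> i t)"
  using assms by (induction rule: finite_induct) (auto intro: tpoly_plus tpoly.zero)

lemma tpoly_shift:
  assumes "tpoly A L \<phi>" and sub: "\<And>p. p \<in> A \<Longrightarrow> p + d \<in> A'"
  shows "tpoly A' (L * norm a) (\<lambda>t. \<phi> t * (a * cis (- of_int d * t)))"
  using assms(1)
proof induction
  case (zero L)
  then show ?case by (simp add: tpoly.zero)
next
  case (add L \<phi> p b L')
  have "tpoly A' (L' * norm a) (\<lambda>t. \<phi> t * (a * cis (- of_int d * t)) + (b * a) * cis (- of_int (p + d) * t))"
  proof (rule tpoly.add[OF add.IH])
    show "p + d \<in> A'" using sub add by blast
    have "(L + norm b) * norm a \<le> L' * norm a" using add by (intro mult_right_mono) auto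
    then show "L * norm a + norm (b * a) \<le> L' * norm a" by (simp add: norm_mult algebra_simps)
  qed
  moreover have "cis (- of_int (p + d) * t) = cis (- of_int p * t) * cis (- of_int d * t)" for t
    by (simp add: cis_mult algebra_simps)
  ultimately show ?case by (simp add: algebra_simps)
qed

lemma tpoly_cmult:
  assumes "tpoly A L \<phi>" shows "tpoly A (norm a * L) (\<lambda>t. a * \<phi> t)"
  using tpoly_shift[OF assms, of 0 A a] by (simp add: mult.commute)

lemma tpoly_continuous: "tpoly A L \<phi> \<Longrightarrow> continuous_on S \<phi>"
  by (induction rule: tpoly.induct) (auto intro!: continuous_intros)

text \<open>The stable substitute for orthogonality: test frequencies that avoid the large
  coefficients contribute an error controlled by \<open>e\<close> and the coefficient budget
  \<open>L\<close>, rather than exactly 0.\<close>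

lemma pairing_tpoly_bound:
  assumes "tpoly A L \<phi>" and "finite J" "\<And>j. j \<notin> J \<Longrightarrow> c j = 0"
    and small: "\<And>p. p \<in> A \<Longrightarrow> norm (c p) \<le> e" and "0 \<le> e"
  shows "norm (pairing (trig J c) \<phi>) \<le> e * L"
  using assms(1)
proof induction
  case (zero L)
  then show ?case using \<open>0 \<le> e\<close> by (simp add: pairing_def)
next
  case (add L \<phi> p a L')
  have "pairing (trig J c) (\<lambda>t. \<phi> t + a * cis (- of_int p * t)) = pairing (trig J c) \<phi> + a * c p"
  proof -
    have "pairing (trig J c) (\<lambda>t. \<phi> t + a * cis (- of_int p * t))
        = pairing (trig J c) \<phi> + pairing (trig J c) (\<lambda>t. a * cis (- of_int p * t))"
      by (intro pairing_add continuous_on_trig tpoly_continuous[OF add.hyps(1)] continuous_intros)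
    also have "pairing (trig J c) (\<lambda>t. a * cis (- of_int p * t)) = a * c p"
      by (subst pairing_cmult, subst pairing_trig_cis) (use assms(2,3) in auto)
    finally show ?thesis .
  qed
  then have "norm (pairing (trig J c) (\<lambda>t. \<phi> t + a * cis (- of_int p * t))) \<le> e * L + norm a * e"
    using add.IH small[OF add.hyps(2)]
    by (metis (no_types) add_mono mult_left_mono norm_ge_zero norm_mult norm_triangle_le)
  also have "\<dots> \<le> e * L'"
    using add.hyps(3) \<open>0 \<le> e\<close> mult_left_mono[of "L + norm a" L' e] by (simp add: algebra_simps)
  finally show ?case .
qed

section \<open>A weak Littlewood theorem\<close>

text \<open>Take the maximum \<open>m\<close> of \<open>E\<close>, delete it together with
  \<open>X m\<close>, and repeat. Every choice costs at most \<open>Suc x\<close> elements, and all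
  later choices are smaller than \<open>m\<close>, so only sets \<open>X u\<close> of previously
  chosen \<open>u\<close> have to be avoided.\<close>

lemma greedy_subset:
  fixes E :: "int set"
  assumes "finite E" "M * Suc x \<le> card E" and X: "\<And>m. finite (X m)" "\<And>m. card (X m) \<le> x"
  shows "\<exists>D\<subseteq>E. card D = M \<and> (\<forall>u\<in>D. \<forall>v\<in>D. v < u \<longrightarrow> v \<notin> X u)"
  using assms(1,2)
proof (induction M arbitrary: E)
  case 0
  then show ?case by (intro exI[of _ "{}"]) auto
next
  case (Suc M)
  have "E \<noteq> {}" using Suc.prems by auto
  define m where "m = Max E"
  have m: "m \<in> E" "\<And>v. v \<in> E \<Longrightarrow> v \<le> m"
    using Suc.prems \<open>E \<noteq> {}\<close> by (auto simp: m_def)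
  define E' where "E' = E - {m} - X m"
  have "card (E - {m}) - card (X m) \<le> card E'"
    unfolding E'_def using X by (intro diff_card_le_card_Diff) auto
  moreover have "card (E - {m}) = card E - 1" using m Suc.prems by simp
  ultimately have "card E - 1 - x \<le> card E'" using X(2)[of m] by linarith
  then have "M * Suc x \<le> card E'" using Suc.prems by simp
  moreover have "finite E'" using Suc.prems by (simp add: E'_def)
  ultimately obtain D where D: "D \<subseteq> E'" "card D = M" "\<forall>u\<in>D. \<forall>v\<in>D. v < u \<longrightarrow> v \<notin> X u"
    using Suc.IH[of E'] by meson
  have "finite D" using D(1) \<open>finite E'\<close> by (rule finite_subset)
  have "m \<notin> D" using D(1) by (auto simp: E'_def)
  show ?case
  proof (intro exI[of _ "insert m D"] conjI)
    show "insert m D \<subseteq> E" using D m by (auto simp: E'_def)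
    show "card (insert m D) = Suc M" using \<open>finite D\<close> \<open>m \<notin> D\<close> D by simp
    show "\<forall>u\<in>insert m D. \<forall>v\<in>insert m D. v < u \<longrightarrow> v \<notin> X u"
    proof (intro ballI impI)
      fix u v assume uv: "u \<in> insert m D" "v \<in> insert m D" "v < u"
      have "u \<le> m" using uv(1) m D(1) by (auto simp: E'_def)
      then have "v \<in> D" using uv by auto
      then show "v \<notin> X u" using D(1,3) uv(1,3) by (auto simp: E'_def)
    qed
  qed
qed

lemma card_upper_tail:
  fixes E :: "int set"
  assumes "finite E" "r \<le> card E"
  shows "\<exists>\<theta>. card (E \<inter> {\<theta>..}) = r"
  using assms
proof (induction "card E" arbitrary: E)
  case 0
  then show ?case by auto
next
  case (Suc n)
  show ?case
  proof (cases "r = card E")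
    case True
    have "E \<inter> {Min E..} = E" using Suc.prems by auto
    then show ?thesis using True by (intro exI[of _ "Min E"]) simp
  next
    case False
    define m where "m = Min E"
    have ne: "E \<noteq> {}" using Suc.hyps(2) by auto
    have "m \<in> E" using ne Suc.prems by (simp add: m_def)
    then have "n = card (E - {m})" "r \<le> card (E - {m})"
      using Suc.hyps(2) Suc.prems False by auto
    then obtain \<theta> where \<theta>: "card ((E - {m}) \<inter> {\<theta>..}) = r"
      using Suc.hyps(1)[of "E - {m}"] Suc.prems by auto
    \<comment> \<open>The threshold \<open>m + 1\<close> discards the minimum \<open>m\<close> even
      when \<open>\<theta>\<close> lies at or below it.\<close>
    have "E \<inter> {max \<theta> (m + 1)..} = (E - {m}) \<inter> {\<theta>..}"
    proof -
      have "\<forall>e\<in>E. m \<le> e" using Suc.prems by (simp add: m_def)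
      then show ?thesis by (auto simp: less_le add1_zle_eq)
    qed
    then show ?thesis using \<theta> by (intro exI[of _ "max \<theta> (m + 1)"]) simp
  qed
qed

text \<open>
  One step of the Cohen--Davenport construction. Here \<open>s\<close> is the average of \<open>M\<close> unimodular numbers and
  \<open>w\<close> the one-sided half of the double sum for \<open>\<bar>s\<bar>\<^sup>2\<close>, so that a large \<open>s\<close> forces a large \<open>Re w\<close>.
  The powers of \<open>\<eta>\<close> balance the loss \<open>\<eta>\<^sup>4\<close> of \<open>\<phi>\<close> against the gain \<open>\<eta>\<^sup>3\<close> from \<open>s\<close>.
\<close>
lemma damped_step_bound:
  fixes w \<phi> s :: complex and \<eta> M :: real
  assumes \<eta>: "0 < \<eta>" "\<eta> \<le> 1/2" and M: "4 \<le> \<eta>^2 * M" and "norm \<phi> \<le> 1"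
    and w: "norm w \<le> 1/2" and s: "(norm s)^2 = 1 / M + 2 * Re w" "norm s \<le> 1"
  shows "norm ((1 - \<eta>^4) * \<phi> - \<eta>^2 * (\<phi> * w) + (\<eta>^3 / 2) * s) \<le> 1"
proof -
  define \<sigma> where "\<sigma> = norm s"
  have \<sigma>: "0 \<le> \<sigma>" "\<sigma> \<le> 1" using s by (auto simp: \<sigma>_def)
  have "M > 0" using M \<eta> by (smt (verit) mult_nonneg_nonpos zero_le_power2)
  have e4: "\<eta>^4 = \<eta>^2 * \<eta>^2" by (simp flip: power_add)
  have eta2: "\<eta>^2 \<le> 1/4" using power_mono[of \<eta> "1/2" 2] \<eta> by (simp add: power2_eq_square)
  have eta4: "0 < \<eta>^4" "\<eta>^4 \<le> 1/16" using power_mono[of \<eta> "1/2" 4] \<eta> by (auto simp: power_divide)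
  have eta3: "0 < \<eta>^3" "\<eta>^3 \<le> 1/8" using power_mono[of \<eta> "1/2" 3] \<eta> by (auto simp: power_divide)
  have invM: "\<eta>^2 / M \<le> \<eta>^4 / 4"
  proof -
    have "4 * \<eta>^2 \<le> \<eta>^2 * (\<eta>^2 * M)" using M \<eta> by (simp add: mult_left_mono mult.commute)
    then show ?thesis using \<open>M > 0\<close> unfolding e4 by (simp add: field_simps)
  qed
  have Re_w: "2 * Re w = \<sigma>^2 - 1 / M" using s by (simp add: \<sigma>_def)
  have "(norm (complex_of_real (1 - \<eta>^4) - complex_of_real (\<eta>^2) * w))\<^sup>2
      = (1 - \<eta>^4)^2 - (1 - \<eta>^4) * \<eta>^2 * (2 * Re w) + \<eta>^4 * (norm w)^2"
    by (simp only: cmod_power2) (simp add: power2_eq_square e4 algebra_simps)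
  also have "\<dots> \<le> (1 - \<eta>^4)^2 - (1 - \<eta>^4) * \<eta>^2 * (\<sigma>^2 - 1 / M) + \<eta>^4 / 4"
  proof -
    have "(norm w)^2 \<le> (1/2)^2" using w by (intro power_mono) auto
    then have "\<eta>^4 * (norm w)^2 \<le> \<eta>^4 * (1/4)" using eta4 by (intro mult_left_mono) (auto simp: power2_eq_square)
    then show ?thesis using Re_w by simp
  qed
  \<comment> \<open>Of the \<open>- 2 * \<eta>^4\<close> from the square, less than half pays for
    \<open>norm w\<close>, \<open>\<eta>^2 / M\<close> and \<open>(\<eta>^4)^2\<close>: the bill is
    \<open>(1/4 + 1/4 + 1/16) * \<eta>^4\<close>. Half of the gain in \<open>\<sigma>^2\<close>
    survives the factor \<open>1 - \<eta>^4\<close>.\<close>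
  also have "\<dots> \<le> 1 - \<eta>^4 - \<eta>^2 * \<sigma>^2 / 2"
  proof -
    have a: "(\<eta>^4)^2 \<le> \<eta>^4 / 16"
      using mult_left_mono[of "\<eta>^4" "1/16" "\<eta>^4"] eta4 by (simp only: power2_eq_square) simp
    have b: "(1 - \<eta>^4) * (\<eta>^2 / M) \<le> \<eta>^4 / 4"
    proof -
      have "(1 - \<eta>^4) * (\<eta>^2 / M) \<le> 1 * (\<eta>^2 / M)"
        using eta4 \<open>M > 0\<close> by (intro mult_right_mono) auto
      then show ?thesis unfolding mult_1 using invM by linarith
    qed
    have c: "1/2 * (\<eta>^2 * \<sigma>^2) \<le> (1 - \<eta>^4) * (\<eta>^2 * \<sigma>^2)"
      using eta4 by (intro mult_right_mono) auto
    have "(1 - \<eta>^4)^2 - (1 - \<eta>^4) * \<eta>^2 * (\<sigma>^2 - 1 / M) + \<eta>^4 / 4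
        = 1 - 2 * \<eta>^4 + (\<eta>^4)^2 - (1 - \<eta>^4) * (\<eta>^2 * \<sigma>^2) + (1 - \<eta>^4) * (\<eta>^2 / M) + \<eta>^4 / 4"
      by (simp add: power2_eq_square algebra_simps)
    then show ?thesis using a b c eta4 by linarith
  qed
  also have "\<dots> \<le> (1 - \<eta>^3 / 2 * \<sigma>)^2"
  proof -
    \<comment> \<open>Completing the square absorbs the linear term
      \<open>\<eta>^3 * \<sigma>\<close> into \<open>\<eta>^4\<close> and
      \<open>\<eta>^2 * \<sigma>^2\<close>; here the exponents 4, 3 and 2 balance.\<close>
    have "0 \<le> (\<eta>^2 - \<eta> * \<sigma> / 2)^2" by simp
    also have "\<dots> = \<eta>^4 - \<eta>^3 * \<sigma> + \<eta>^2 * \<sigma>^2 / 4"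
      by (simp add: power2_eq_square power3_eq_cube e4 algebra_simps)
    finally have "\<eta>^3 * \<sigma> \<le> \<eta>^4 + \<eta>^2 * \<sigma>^2 / 2"
      using mult_nonneg_nonneg[of "\<eta>^2" "\<sigma>^2"] zero_le_power2[of \<eta>] zero_le_power2[of \<sigma>] by linarith
    moreover have "(1 - \<eta>^3 / 2 * \<sigma>)^2 = 1 - \<eta>^3 * \<sigma> + (\<eta>^3 / 2 * \<sigma>)^2"
      by (simp add: power2_diff)
    moreover have "0 \<le> (\<eta>^3 / 2 * \<sigma>)^2" by simp
    ultimately show ?thesis by linarith
  qed
  finally have "norm (complex_of_real (1 - \<eta>^4) - complex_of_real (\<eta>^2) * w) \<le> 1 - \<eta>^3 / 2 * \<sigma>"
  proof (rule power2_le_imp_le)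
    have "\<eta>^3 / 2 * \<sigma> \<le> 1 * 1" using eta3 \<sigma> by (intro mult_mono) auto
    then show "0 \<le> 1 - \<eta>^3 / 2 * \<sigma>" by simp
  qed
  moreover have "norm (complex_of_real (\<eta>^3 / 2) * s) = \<eta>^3 / 2 * \<sigma>"
    unfolding norm_mult norm_of_real \<sigma>_def using eta3 by simp
  moreover have "norm (\<phi> * (complex_of_real (1 - \<eta>^4) - complex_of_real (\<eta>^2) * w))
      \<le> 1 * norm (complex_of_real (1 - \<eta>^4) - complex_of_real (\<eta>^2) * w)"
    unfolding norm_mult using assms by (intro mult_right_mono) auto
  ultimately have "norm (\<phi> * (complex_of_real (1 - \<eta>^4) - complex_of_real (\<eta>^2) * w)
      + complex_of_real (\<eta>^3 / 2) * s) \<le> 1"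
    by (intro norm_triangle_le) simp
  then show ?thesis by (simp add: algebra_simps)
qed

text \<open>In the double sum for the squared modulus, swapping \<open>x\<close> and
  \<open>y\<close> conjugates a term and keeps its real part, so both triangles contribute equally,
  while the diagonal contributes \<open>card D\<close>.\<close>

lemma norm_sum_unit_square:
  fixes z :: "int \<Rightarrow> complex"
  assumes "finite D" "\<And>x. x \<in> D \<Longrightarrow> norm (z x) = 1"
  shows "(norm (\<Sum>x\<in>D. z x))^2
    = card D + 2 * Re (\<Sum>(x, y)\<in>{(x, y)\<in>D \<times> D. y < x}. z x * cnj (z y))"
proof -
  define g where "g = (\<lambda>(x, y). Re (z x * cnj (z y)))"
  define Lo where "Lo = {(x, y)\<in>D \<times> D. y < x}"
  define Up where "Up = {(x, y)\<in>D \<times> D. x < y}"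
  define Di where "Di = (\<lambda>x. (x, x)) ` D"
  have fin: "finite Lo" "finite Up" "finite Di"
    using assms(1) by (auto simp: Lo_def Up_def Di_def intro: finite_subset[of _ "D \<times> D"])
  have "complex_of_real ((norm (\<Sum>x\<in>D. z x))^2) = (\<Sum>x\<in>D. z x) * cnj (\<Sum>x\<in>D. z x)"
    by (rule complex_norm_square)
  also have "\<dots> = (\<Sum>(x, y)\<in>D \<times> D. z x * cnj (z y))"
    by (simp add: sum_product sum.cartesian_product cnj_sum)
  finally have "Re (complex_of_real ((norm (\<Sum>x\<in>D. z x))^2)) = (\<Sum>p\<in>D \<times> D. g p)"
    by (simp add: Re_sum g_def case_prod_unfold)
  then have "(norm (\<Sum>x\<in>D. z x))^2 = (\<Sum>p\<in>D \<times> D. g p)" by (simp only: Re_complex_of_real)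
  also have "D \<times> D = Lo \<union> Up \<union> Di" by (auto simp: Lo_def Up_def Di_def)
  also have "sum g (Lo \<union> Up \<union> Di) = sum g Lo + sum g Up + sum g Di"
    using fin by (subst sum.union_disjoint; (subst sum.union_disjoint)?) (auto simp: Lo_def Up_def Di_def)
  also have "sum g Up = sum g Lo"
    by (rule sum.reindex_bij_witness[of _ prod.swap prod.swap]) (auto simp: Lo_def Up_def g_def mult.commute)
  also have "sum g Di = card D"
  proof -
    have "sum g Di = (\<Sum>x\<in>D. g (x, x))"
      unfolding Di_def by (subst sum.reindex) (auto simp: inj_on_def)
    also have "\<dots> = (\<Sum>x\<in>D. 1)"
    proof (rule sum.cong)
      fix x assume "x \<in> D"
      have "z x * cnj (z x) = complex_of_real ((norm (z x))^2)" by (rule complex_norm_square[symmetric])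
      then show "g (x, x) = 1" using assms(2)[OF \<open>x \<in> D\<close>]
        by (simp only: g_def prod.case) simp
    qed simp
    finally show ?thesis by simp
  qed
  finally show ?thesis by (simp add: Re_sum g_def Lo_def case_prod_unfold)
qed

text \<open>
  The coefficients off \<open>E\<close> need only be tiny, not zero: this makes the bound below stable under
  small perturbations of the coefficients.
\<close>
definition admissible ::
  "real \<Rightarrow> real \<Rightarrow> real \<Rightarrow> int set \<Rightarrow> (int \<Rightarrow> complex) \<Rightarrow> int set \<Rightarrow> bool" where
  "admissible C \<delta> \<epsilon> J c E \<longleftrightarrow>
    finite J \<and> (\<forall>j. j \<notin> J \<longrightarrow> c j = 0) \<and> (\<forall>j\<in>E. \<delta> \<le> norm (c j)) \<and> (\<forall>j. j \<notin> E \<longrightarrow> norm (c j) \<le> \<epsilon>) \<and>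
    integral {-pi..pi} (\<lambda>t. norm (trig J c t)) \<le> 2 * pi * C"

lemma admissible_finite:
  assumes "admissible C \<delta> \<epsilon> J c E" "0 < \<delta>" shows "finite E"
proof (rule finite_subset)
  show "finite J" using assms by (simp add: admissible_def)
  show "E \<subseteq> J" using assms by (force simp: admissible_def)
qed

section \<open>Building test functions step by step\<close>

text \<open>Shrinking \<open>\<phi>\<close> by the factor \<open>1 - \<eta>^4\<close> costs at most
  \<open>\<eta>^3 * \<delta> / 8\<close>, as its pairing is at most \<open>C\<close>. The correction
  \<open>\<phi> W\<close> has its frequencies in \<open>A1\<close>, which avoids \<open>E\<close>,
  so it costs at most \<open>\<eta>^3 * \<delta> / 4\<close>. The average \<open>s\<close> gains
  \<open>\<eta>^3 * \<delta> / 2\<close>.\<close>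

lemma test_function_step:
  fixes \<eta> \<delta> \<epsilon> C L :: real
  assumes adm: "admissible C \<delta> \<epsilon> J c E" and "0 < \<delta>" "0 < \<epsilon>"
    and \<phi>: "tpoly A L \<phi>" "\<And>t. norm (\<phi> t) \<le> 1" and "finite A"
    and D: "D \<subseteq> E" "card D = M" and "0 < M"
    and avoid: "\<And>p u v. p \<in> A \<Longrightarrow> u \<in> D \<Longrightarrow> v \<in> D \<Longrightarrow> v < u \<Longrightarrow> p + (u - v) \<notin> E"
    and \<eta>: "0 < \<eta>" "\<eta> \<le> 1/2" "4 \<le> \<eta>^2 * M" "\<eta> * C \<le> \<delta> / 8"
    and small: "\<epsilon> * L \<le> \<eta> * \<delta> / 4"
  defines "P \<equiv> {(x, y)\<in>D \<times> D. y < x}"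
  defines "A1 \<equiv> (\<lambda>(p, (x, y)). p + (x - y)) ` (A \<times> P)"
  shows "\<exists>\<phi>'. tpoly (A \<union> A1 \<union> D) (3 * L + 1) \<phi>' \<and> (\<forall>t. norm (\<phi>' t) \<le> 1) \<and>
    Re (pairing (trig J c) \<phi>) + \<eta>^3 * \<delta> / 8 \<le> Re (pairing (trig J c) \<phi>')"
proof -
  have c: "finite J" "\<And>j. j \<notin> J \<Longrightarrow> c j = 0" "\<And>j. j \<in> E \<Longrightarrow> \<delta> \<le> norm (c j)"
    "\<And>j. j \<notin> E \<Longrightarrow> norm (c j) \<le> \<epsilon>" "integral {-pi..pi} (\<lambda>t. norm (trig J c t)) \<le> 2 * pi * C"
    using adm by (auto simp: admissible_def)
  have "finite D" using D(2) \<open>0 < M\<close> card_ge_0_finite by blast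
  then have finP: "finite P" by (auto simp: P_def intro: finite_subset[of _ "D \<times> D"])
  have "L \<ge> 0" using \<phi> tpoly_nonneg by blast
  \<comment> \<open>Phases aligned with \<open>c\<close>, so that all terms of the pairing with
    \<open>s\<close> are positive and their average is at least \<open>\<delta>\<close>.\<close>
  define u where "u x = cnj (sgn (c x))" for x
  define z where "z x t = u x * cis (- of_int x * t)" for x t
  define W where "W t = (\<Sum>(x, y)\<in>P. z x t * cnj (z y t)) / (of_nat M)^2" for t
  define s where "s t = (\<Sum>x\<in>D. z x t) / of_nat M" for t
  define \<phi>' where "\<phi>' t = (1 - \<eta>^4) * \<phi> t - \<eta>^2 * (\<phi> t * W t) + (\<eta>^3 / 2) * s t" for t
  have u: "norm (u x) = 1" if "x \<in> D" for x
  proof -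
    have "c x \<noteq> 0" using c(3)[of x] that D \<open>0 < \<delta>\<close> by auto
    then show ?thesis by (simp add: u_def norm_sgn)
  qed
  have uc: "u x * c x = of_real (norm (c x))" for x
  proof -
    have "u x * c x = (c x * cnj (c x)) / of_real (norm (c x))"
      by (simp add: u_def sgn_div_norm scaleR_conv_of_real divide_inverse mult_ac)
    also have "\<dots> = of_real ((norm (c x))^2) / of_real (norm (c x))"
      by (simp only: complex_norm_square)
    finally show ?thesis by (simp add: power2_eq_square)
  qed
  have zz: "norm (z x t) = 1" if "x \<in> D" for x t using u[OF that] by (simp add: z_def norm_mult)
  have cardP: "real (card P) \<le> (real M)^2 / 2"
  proof -
    have "card P + card (prod.swap ` P) = card (P \<union> prod.swap ` P)"
      by (rule card_Un_disjoint[symmetric]) (use finP in \<open>auto simp: P_def\<close>)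
    also have "\<dots> \<le> card (D \<times> D)"
      by (rule card_mono) (use \<open>finite D\<close> in \<open>auto simp: P_def\<close>)
    finally have "2 * card P \<le> M * M" using D by (simp add: card_image card_cartesian_product)
    then have "real (2 * card P) \<le> real (M * M)" by (rule of_nat_mono)
    then show ?thesis by (simp add: power2_eq_square)
  qed
  have normW: "norm (W t) \<le> 1/2" for t
  proof -
    have "norm (\<Sum>(x, y)\<in>P. z x t * cnj (z y t)) \<le> (\<Sum>p\<in>P. 1)"
      by (rule order_trans[OF norm_sum], rule sum_mono) (auto simp: P_def norm_mult zz)
    then show ?thesis using cardP \<open>0 < M\<close> by (simp add: W_def norm_divide norm_power field_simps)
  qed
  have norms: "norm (s t) \<le> 1" for t
  proof -
    have "norm (\<Sum>x\<in>D. z x t) \<le> (\<Sum>x\<in>D. 1)"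
      by (rule order_trans[OF norm_sum], rule sum_mono) (auto simp: zz)
    then show ?thesis using D \<open>0 < M\<close> by (simp add: s_def norm_divide field_simps)
  qed
  have s2: "(norm (s t))^2 = 1 / real M + 2 * Re (W t)" for t
  proof -
    have "(norm (\<Sum>x\<in>D. z x t))^2 = real M + 2 * Re (\<Sum>(x, y)\<in>P. z x t * cnj (z y t))"
      using norm_sum_unit_square[OF \<open>finite D\<close>, of "\<lambda>x. z x t"] zz D by (simp add: P_def)
    moreover have "Re (W t) = Re (\<Sum>(x, y)\<in>P. z x t * cnj (z y t)) / (real M)^2"
      unfolding W_def by (metis Re_divide_of_real of_real_of_nat_eq of_real_power)
    ultimately show ?thesis using \<open>0 < M\<close>
      by (simp add: s_def norm_divide power_divide add_divide_distrib power2_eq_square)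
  qed
  have bound: "norm (\<phi>' t) \<le> 1" for t
    unfolding \<phi>'_def using damped_step_bound[OF \<eta>(1-3) \<phi>(2) normW s2 norms] by simp
  have tW: "tpoly A1 L (\<lambda>t. \<phi> t * W t)"
  proof -
    have "tpoly A1 (L * norm (u x * cnj (u y) / (of_nat M)^2))
        (\<lambda>t. \<phi> t * (u x * cnj (u y) / (of_nat M)^2 * cis (- of_int (x - y) * t)))"
      if "(x, y) \<in> P" for x y
      by (rule tpoly_shift[OF \<phi>(1)]) (use that in \<open>force simp: A1_def\<close>)
    then have "tpoly A1 (\<Sum>q\<in>P. L / (real M)^2)
      (\<lambda>t. \<Sum>q\<in>P. \<phi> t * (u (fst q) * cnj (u (snd q)) / (of_nat M)^2 * cis (- of_int (fst q - snd q) * t)))"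
    proof (intro tpoly_sum finP)
      fix q assume A: "\<And>x y. (x, y) \<in> P \<Longrightarrow> tpoly A1 (L * norm (u x * cnj (u y) / (of_nat M)^2))
        (\<lambda>t. \<phi> t * (u x * cnj (u y) / (of_nat M)^2 * cis (- of_int (x - y) * t)))" and q: "q \<in> P"
      have "norm (u (fst q) * cnj (u (snd q)) / (of_nat M)^2) = 1 / (real M)^2"
        using q u by (auto simp: P_def norm_divide norm_mult norm_power)
      then show "tpoly A1 (L / (real M)^2)
        (\<lambda>t. \<phi> t * (u (fst q) * cnj (u (snd q)) / (of_nat M)^2 * cis (- of_int (fst q - snd q) * t)))"
        using A[of "fst q" "snd q"] q by simp
    qed
    moreover have "(\<lambda>t. \<Sum>q\<in>P. \<phi> t * (u (fst q) * cnj (u (snd q)) / (of_nat M)^2 * cis (- of_int (fst q - snd q) * t)))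
       = (\<lambda>t. \<phi> t * W t)"
    proof
      fix t
      have "z x t * cnj (z y t) = u x * cnj (u y) * cis (- of_int (x - y) * t)" for x y
        by (simp add: z_def cis_cnj cis_mult algebra_simps)
      then show "(\<Sum>q\<in>P. \<phi> t * (u (fst q) * cnj (u (snd q)) / (of_nat M)^2 * cis (- of_int (fst q - snd q) * t))) = \<phi> t * W t"
        by (simp add: W_def sum_divide_distrib sum_distrib_left case_prod_unfold)
    qed
    ultimately have "tpoly A1 (\<Sum>q\<in>P. L / (real M)^2) (\<lambda>t. \<phi> t * W t)" by simp
    \<comment> \<open>The coefficients of \<open>W\<close> have total size
      \<open>card P / M^2\<close>, which is at most 1, so multiplication by \<open>W\<close> does
      not enlarge the budget.\<close>
    moreover have "(\<Sum>q\<in>P. L / (real M)^2) \<le> L"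
    proof -
      have "real (card P) \<le> (real M)^2" using cardP zero_le_power2[of "real M"] by linarith
      then have "card P * L \<le> (real M)^2 * L" using \<open>0 \<le> L\<close> by (rule mult_right_mono)
      then show ?thesis using \<open>0 < M\<close> by (simp add: field_simps)
    qed
    ultimately show ?thesis by (rule tpoly_weaken)
  qed
  have ts: "tpoly D 1 s"
  proof -
    have "tpoly D (\<Sum>x\<in>D. 1 / real M) (\<lambda>t. \<Sum>x\<in>D. (u x / of_nat M) * cis (- of_int x * t))"
    proof (intro tpoly_sum \<open>finite D\<close>)
      fix x assume "x \<in> D"
      then show "tpoly D (1 / real M) (\<lambda>t. (u x / of_nat M) * cis (- of_int x * t))"
        using tpoly_monom[of x D "u x / of_nat M"] u[of x] by (simp add: norm_divide)
    qed
    then show ?thesis using \<open>0 < M\<close> D by (simp add: s_def[abs_def] z_def sum_divide_distrib)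
  qed
  have "tpoly (A \<union> A1 \<union> D) (norm (complex_of_real (1 - \<eta>^4)) * L + norm (complex_of_real (- (\<eta>^2))) * L
      + norm (complex_of_real (\<eta>^3 / 2)) * 1)
    (\<lambda>t. complex_of_real (1 - \<eta>^4) * \<phi> t + complex_of_real (- (\<eta>^2)) * (\<phi> t * W t) + complex_of_real (\<eta>^3 / 2) * s t)"
    by (intro tpoly_plus tpoly_cmult tpoly_mono[OF \<phi>(1)] tpoly_mono[OF tW] tpoly_mono[OF ts]) auto
  moreover have "(\<lambda>t. complex_of_real (1 - \<eta>^4) * \<phi> t + complex_of_real (- (\<eta>^2)) * (\<phi> t * W t)
      + complex_of_real (\<eta>^3 / 2) * s t) = \<phi>'"
    by (rule ext) (simp add: \<phi>'_def)
  \<comment> \<open>A crude count suffices: all three factors have modulus at most 1. Only the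
    independence of the bound from \<open>c\<close> and \<open>E\<close> matters.\<close>
  moreover have "norm (complex_of_real (1 - \<eta>^4)) * L + norm (complex_of_real (- (\<eta>^2))) * L
      + norm (complex_of_real (\<eta>^3 / 2)) * 1 \<le> 3 * L + 1"
  proof -
    have p: "\<eta>^n \<le> 1" "0 \<le> \<eta>^n" for n using \<eta> by (auto intro: power_le_one)
    have "\<bar>1 - \<eta>^4\<bar> * L \<le> 1 * L" "\<bar>- (\<eta>^2)\<bar> * L \<le> 1 * L"
      by (intro mult_right_mono \<open>0 \<le> L\<close>; use p[of 4] p[of 2] in simp)+
    moreover have "\<bar>\<eta>^3 / 2\<bar> \<le> 1" using p[of 3] by simp
    ultimately show ?thesis using \<open>0 \<le> L\<close> unfolding norm_of_real by linarith
  qed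
  ultimately have t': "tpoly (A \<union> A1 \<union> D) (3 * L + 1) \<phi>'"
    using tpoly_weaken by simp
  let ?V = "pairing (trig J c)"
  have "?V \<phi>' = ?V (\<lambda>t. (complex_of_real (1 - \<eta>^4) * \<phi> t + complex_of_real (- (\<eta>^2)) * (\<phi> t * W t))
      + complex_of_real (\<eta>^3 / 2) * s t)"
    by (simp add: \<phi>'_def[abs_def])
  also have "\<dots> = complex_of_real (1 - \<eta>^4) * ?V \<phi> + complex_of_real (- (\<eta>^2)) * ?V (\<lambda>t. \<phi> t * W t)
      + complex_of_real (\<eta>^3 / 2) * ?V s"
    by (simp only: pairing_add pairing_cmult continuous_on_trig tpoly_continuous[OF \<phi>(1)]
        tpoly_continuous[OF tW] tpoly_continuous[OF ts] continuous_on_add continuous_on_mult_left)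
  finally have V': "Re (?V \<phi>') = (1 - \<eta>^4) * Re (?V \<phi>) - \<eta>^2 * Re (?V (\<lambda>t. \<phi> t * W t)) + \<eta>^3 / 2 * Re (?V s)"
    by (simp only: plus_complex.sel times_complex.sel Re_complex_of_real Im_complex_of_real
        mult_zero_left diff_0_right mult_minus_left add_uminus_conv_diff)
  have V0: "Re (?V \<phi>) \<le> C"
    by (rule order_trans[OF complex_Re_le_cmod])
      (rule norm_pairing_le[OF continuous_on_trig tpoly_continuous[OF \<phi>(1)] \<phi>(2) c(5)])
  have VW: "Re (?V (\<lambda>t. \<phi> t * W t)) \<le> \<eta> * \<delta> / 4"
  proof -
    have "norm (?V (\<lambda>t. \<phi> t * W t)) \<le> \<epsilon> * L"
    proof (rule pairing_tpoly_bound[OF tW c(1,2)])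
      fix p assume "p \<in> A1"
      then have "p \<notin> E" using avoid by (auto simp: A1_def P_def)
      then show "norm (c p) \<le> \<epsilon>" by (rule c(4))
    qed (use \<open>0 < \<epsilon>\<close> in auto)
    then show ?thesis using small complex_Re_le_cmod[of "?V (\<lambda>t. \<phi> t * W t)"] by linarith
  qed
  have Vs: "\<delta> \<le> Re (?V s)"
  proof -
    have "?V (\<lambda>t. \<Sum>x\<in>F. (u x / of_nat M) * cis (- of_int x * t)) = (\<Sum>x\<in>F. u x / of_nat M * c x)"
      if "finite F" for F
      using that
    proof induction
      case empty
      then show ?case by (simp add: pairing_def)
    next
      case (insert x F)
      have "?V (\<lambda>t. (u x / of_nat M) * cis (- of_int x * t) + (\<Sum>x\<in>F. (u x / of_nat M) * cis (- of_int x * t)))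
        = ?V (\<lambda>t. (u x / of_nat M) * cis (- of_int x * t)) + ?V (\<lambda>t. \<Sum>x\<in>F. (u x / of_nat M) * cis (- of_int x * t))"
        by (intro pairing_add continuous_on_trig continuous_intros)
      then show ?case using insert
        by (simp only: sum.insert pairing_cmult pairing_trig_cis[OF c(1,2)] not_False_eq_True)
    qed
    from this[OF \<open>finite D\<close>] have "?V s = (\<Sum>x\<in>D. u x * c x) / of_nat M"
      by (simp add: s_def[abs_def] z_def sum_divide_distrib)
    also have "\<dots> = of_real ((\<Sum>x\<in>D. norm (c x)) / M)" by (simp add: uc)
    finally have "Re (?V s) = (\<Sum>x\<in>D. norm (c x)) / M" by (simp only: Re_complex_of_real)
    moreover have "(\<Sum>x\<in>D. \<delta>) \<le> (\<Sum>x\<in>D. norm (c x))" using c(3) D by (intro sum_mono) auto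
    ultimately show ?thesis using D \<open>0 < M\<close> by (simp add: pos_le_divide_eq mult.commute)
  qed
  have "Re (?V \<phi>) + \<eta>^3 * \<delta> / 8 \<le> Re (?V \<phi>')"
  proof -
    have e4: "\<eta>^4 * Re (?V \<phi>) \<le> \<eta>^3 * (\<delta> / 8)"
    proof -
      have "\<eta>^4 * Re (?V \<phi>) \<le> \<eta>^4 * C" using V0 \<eta> by (intro mult_left_mono) auto
      also have "\<dots> = \<eta>^3 * (\<eta> * C)" by (simp add: power3_eq_cube power4_eq_xxxx)
      also have "\<dots> \<le> \<eta>^3 * (\<delta> / 8)" using \<eta> by (intro mult_left_mono) auto
      finally show ?thesis .
    qed
    have e2: "\<eta>^2 * Re (?V (\<lambda>t. \<phi> t * W t)) \<le> \<eta>^3 * (\<delta> / 4)"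
    proof -
      have "\<eta>^2 * Re (?V (\<lambda>t. \<phi> t * W t)) \<le> \<eta>^2 * (\<eta> * \<delta> / 4)" using VW \<eta> by (intro mult_left_mono) auto
      then show ?thesis by (simp add: power3_eq_cube power2_eq_square)
    qed
    have e3: "\<eta>^3 / 2 * \<delta> \<le> \<eta>^3 / 2 * Re (?V s)" using Vs \<eta> by (intro mult_left_mono) auto
    have "\<eta>^3 * \<delta> / 8 = \<eta>^3 * (\<delta> / 8)" "\<eta>^3 * (\<delta> / 4) = 2 * (\<eta>^3 * (\<delta> / 8))" "\<eta>^3 / 2 * \<delta> = 4 * (\<eta>^3 * (\<delta> / 8))"
      by simp_all
    then show ?thesis using e4 e2 e3 unfolding V' left_diff_distrib by linarith
  qed
  with t' bound show ?thesis by blast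
qed

text \<open>The threshold \<open>\<theta>\<close> keeps the construction inside the upper part of
  the spectrum: test frequencies lie at or above it, where at most \<open>R\<close> elements of
  \<open>E\<close> are found. The elements of \<open>E\<close> below \<open>\<theta>\<close> are
  still fresh for the next stage.\<close>

definition has_test ::
  "nat \<Rightarrow> nat \<Rightarrow> real \<Rightarrow> real \<Rightarrow> int set \<Rightarrow> (int \<Rightarrow> complex) \<Rightarrow> int set \<Rightarrow> bool" where
  "has_test R a L v J c E \<longleftrightarrow>
    (\<exists>A \<phi> \<theta>. finite A \<and> card A \<le> a \<and> A \<subseteq> {\<theta>..} \<and> card (E \<inter> {\<theta>..}) \<le> R \<and> tpoly A L \<phi> \<and>
      (\<forall>t. norm (\<phi> t) \<le> 1) \<and> v \<le> Re (pairing (trig J c) \<phi>))"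

text \<open>Each stage picks \<open>M\<close> fresh elements of \<open>E\<close> below the current
  threshold and applies \<open>test_function_step\<close>. Since only upward differences are added
  to old frequencies, a bad hit would lie above the old threshold, where \<open>E\<close> has at
  most \<open>R\<close> elements; this makes the greedy selection possible with bounds uniform in
  \<open>c\<close> and \<open>E\<close>.\<close>

lemma test_functions:
  fixes \<eta> \<delta> C :: real and k :: nat
  assumes "0 < \<delta>" "0 < M" and \<eta>: "0 < \<eta>" "\<eta> \<le> 1/2" "4 \<le> \<eta>^2 * real M" "\<eta> * C \<le> \<delta> / 8"
  shows "\<exists>\<epsilon>>0. \<exists>R a L. \<forall>\<epsilon>' J c E. 0 < \<epsilon>' \<longrightarrow> \<epsilon>' \<le> \<epsilon> \<longrightarrow> admissible C \<delta> \<epsilon>' J c E \<longrightarrow> R \<le> card E \<longrightarrow>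
    has_test R a L (k * (\<eta>^3 * \<delta> / 8)) J c E"
proof (induction k)
  case 0
  have "has_test 0 0 0 (real 0 * (\<eta>^3 * \<delta> / 8)) J c E"
    if adm: "admissible C \<delta> \<epsilon>' J c E" for \<epsilon>' J c E
  proof -
    obtain \<theta> where "card (E \<inter> {\<theta>..}) = 0"
      using card_upper_tail[of E 0] admissible_finite[OF adm \<open>0 < \<delta>\<close>] by auto
    then show ?thesis
      unfolding has_test_def
      by (intro exI[of _ "{}"] exI[of _ "\<lambda>_. 0"] exI[of _ \<theta>]) (auto intro: tpoly.zero simp: pairing_def)
  qed
  then show ?case by (intro exI[of _ 1] conjI exI[of _ 0]) auto
next
  case (Suc k)
  then obtain \<epsilon> R a L where \<epsilon>: "\<epsilon> > 0" and IH: "\<And>\<epsilon>' J c E. 0 < \<epsilon>' \<Longrightarrow> \<epsilon>' \<le> \<epsilon> \<Longrightarrow> admissible C \<delta> \<epsilon>' J c E \<Longrightarrow>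
      R \<le> card E \<Longrightarrow> has_test R a L (k * (\<eta>^3 * \<delta> / 8)) J c E"
    by metis
  \<comment> \<open>\<open>R\<close> elements for the old tail, and the number that
    \<open>greedy_subset\<close> consumes when each forbidden set has at most \<open>a * R\<close>
    elements.\<close>
  define R' where "R' = R + M * Suc (a * R)"
  define a' where "a' = a + a * (M * M) + M"
  \<comment> \<open>Small enough that \<open>\<epsilon>0 * L\<close> is at most
    \<open>\<eta> * \<delta> / 4\<close> for the budget of the previous stage.\<close>
  define \<epsilon>0 where "\<epsilon>0 = min \<epsilon> (\<eta> * \<delta> / (4 * (\<bar>L\<bar> + 1)))"
  have "\<epsilon>0 > 0" using \<epsilon> \<eta> \<open>0 < \<delta>\<close> by (simp add: \<epsilon>0_def)
  have step: "has_test R' a' (3 * L + 1) (Suc k * (\<eta>^3 * \<delta> / 8)) J c E"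
    if e: "0 < \<epsilon>'" "\<epsilon>' \<le> \<epsilon>0" and adm: "admissible C \<delta> \<epsilon>' J c E" and card: "R' \<le> card E" for \<epsilon>' J c E
  proof -
    have "\<epsilon>' \<le> \<epsilon>" "R \<le> card E" using e card by (auto simp: \<epsilon>0_def R'_def)
    then obtain A \<phi> \<theta> where A: "finite A" "card A \<le> a" "A \<subseteq> {\<theta>..}" "card (E \<inter> {\<theta>..}) \<le> R" "tpoly A L \<phi>"
      "\<And>t. norm (\<phi> t) \<le> 1" "k * (\<eta>^3 * \<delta> / 8) \<le> Re (pairing (trig J c) \<phi>)"
      using IH[OF e(1) _ adm] unfolding has_test_def by blast
    have "finite E" using admissible_finite[OF adm \<open>0 < \<delta>\<close>] .
    then obtain \<theta>' where \<theta>': "card (E \<inter> {\<theta>'..}) = R'" using card_upper_tail card by blast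
    \<comment> \<open>A tail with \<open>R'\<close> elements cannot start above
      \<open>\<theta>\<close>, since \<open>R < R'\<close>.\<close>
    have "\<theta>' \<le> \<theta>"
    proof (rule ccontr)
      assume "\<not> \<theta>' \<le> \<theta>"
      then have "card (E \<inter> {\<theta>'..}) \<le> card (E \<inter> {\<theta>..})" using \<open>finite E\<close> by (intro card_mono) auto
      then show False using \<theta>' A(4) \<open>0 < M\<close> by (simp add: R'_def)
    qed
    \<comment> \<open>\<open>X u\<close> collects the \<open>v\<close> for which some \<open>p + u - v\<close> hits \<open>E\<close>; such a hit exceeds \<open>\<theta>\<close> since \<open>v < u\<close>.\<close>
    define X where "X m = (\<lambda>(p, e). p + m - e) ` (A \<times> (E \<inter> {\<theta>..}))" for m
    have X: "finite (X m)" "card (X m) \<le> a * R" for m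
    proof -
      show "finite (X m)" using A \<open>finite E\<close> by (simp add: X_def)
      have "card (X m) \<le> card (A \<times> (E \<inter> {\<theta>..}))" unfolding X_def using A \<open>finite E\<close> by (intro card_image_le) auto
      also have "\<dots> \<le> a * R" using A by (simp add: card_cartesian_product mult_le_mono)
      finally show "card (X m) \<le> a * R" .
    qed
    have "E \<inter> {\<theta>'..} = (E \<inter> {\<theta>'..<\<theta>}) \<union> (E \<inter> {\<theta>..})" using \<open>\<theta>' \<le> \<theta>\<close> by auto
    then have "R' \<le> card (E \<inter> {\<theta>'..<\<theta>}) + card (E \<inter> {\<theta>..})" using \<theta>' by (metis card_Un_le)
    then have "M * Suc (a * R) \<le> card (E \<inter> {\<theta>'..<\<theta>})" using A(4) by (simp add: R'_def)
    then obtain D where D: "D \<subseteq> E \<inter> {\<theta>'..<\<theta>}" "card D = M" "\<forall>u\<in>D. \<forall>v\<in>D. v < u \<longrightarrow> v \<notin> X u"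
      using greedy_subset[of "E \<inter> {\<theta>'..<\<theta>}" M "a * R" X] X \<open>finite E\<close> by auto
    have "finite D" using D \<open>finite E\<close> finite_subset by blast
    define P where "P = {(x, y)\<in>D \<times> D. y < x}"
    define A1 where "A1 = (\<lambda>(p, (x, y)). p + (x - y)) ` (A \<times> P)"
    have avoid: "p + (u - v) \<notin> E" if "p \<in> A" "u \<in> D" "v \<in> D" "v < u" for p u v
    proof
      assume "p + (u - v) \<in> E"
      moreover have "\<theta> \<le> p + (u - v)" using that A(3) by auto
      ultimately have "p + u - (p + (u - v)) \<in> X u" using that unfolding X_def by force
      then show False using D(3) that by auto
    qed
    have "\<epsilon>' * L \<le> \<epsilon>' * (\<bar>L\<bar> + 1)" using e by (intro mult_left_mono) auto
    also have "\<dots> \<le> \<epsilon>0 * (\<bar>L\<bar> + 1)" using e by (intro mult_right_mono) auto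
    also have "\<dots> \<le> \<eta> * \<delta> / (4 * (\<bar>L\<bar> + 1)) * (\<bar>L\<bar> + 1)" by (intro mult_right_mono) (auto simp: \<epsilon>0_def)
    also have "\<dots> = \<eta> * \<delta> / 4" by (simp add: field_simps)
    finally have small: "\<epsilon>' * L \<le> \<eta> * \<delta> / 4" .
    have "\<exists>\<phi>'. tpoly (A \<union> A1 \<union> D) (3 * L + 1) \<phi>' \<and> (\<forall>t. norm (\<phi>' t) \<le> 1) \<and>
      Re (pairing (trig J c) \<phi>) + \<eta>^3 * \<delta> / 8 \<le> Re (pairing (trig J c) \<phi>')"
      unfolding A1_def P_def
      by (rule test_function_step[OF adm \<open>0 < \<delta>\<close> e(1) A(5,6,1) _ D(2) \<open>0 < M\<close> avoid \<eta> small]) (use D in auto)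
    then obtain \<phi>' where \<phi>': "tpoly (A \<union> A1 \<union> D) (3 * L + 1) \<phi>'" "\<And>t. norm (\<phi>' t) \<le> 1"
      "Re (pairing (trig J c) \<phi>) + \<eta>^3 * \<delta> / 8 \<le> Re (pairing (trig J c) \<phi>')" by blast
    have "finite P" "card P \<le> M * M"
    proof -
      have "P \<subseteq> D \<times> D" by (auto simp: P_def)
      then show "finite P" "card P \<le> M * M"
        using \<open>finite D\<close> D(2) card_mono[of "D \<times> D" P] finite_subset[of P "D \<times> D"]
        by (auto simp: card_cartesian_product)
    qed
    have cA1: "card A1 \<le> a * (M * M)"
    proof -
      have "card A1 \<le> card (A \<times> P)" unfolding A1_def using A \<open>finite P\<close> by (intro card_image_le) auto
      also have "\<dots> \<le> a * (M * M)" using A \<open>card P \<le> M * M\<close> by (simp add: card_cartesian_product mult_le_mono)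
      finally show ?thesis .
    qed
    have "card (A \<union> A1 \<union> D) \<le> card A + card A1 + card D"
      by (metis add.commute add_left_mono card_Un_le le_trans)
    then have "card (A \<union> A1 \<union> D) \<le> a'" using A cA1 D(2) by (simp add: a'_def)
    moreover have "finite (A \<union> A1 \<union> D)" using A \<open>finite P\<close> \<open>finite D\<close> by (simp add: A1_def)
    moreover have "A \<union> A1 \<union> D \<subseteq> {\<theta>'..}" using A(3) D(1) \<open>\<theta>' \<le> \<theta>\<close> by (fastforce simp: A1_def P_def)
    moreover have "Suc k * (\<eta>^3 * \<delta> / 8) \<le> Re (pairing (trig J c) \<phi>')"
      using \<phi>'(3) A(7) by (simp add: distrib_right)
    ultimately show ?thesis
      unfolding has_test_def using \<phi>' \<theta>'
      by (intro exI[of _ "A \<union> A1 \<union> D"] exI[of _ \<phi>'] exI[of _ \<theta>']) auto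
  qed
  show ?case
    by (rule exI[of _ \<epsilon>0], rule conjI[OF \<open>\<epsilon>0 > 0\<close>], intro exI[of _ R'] exI[of _ a'] exI[of _ "3 * L + 1"])
      (use step in blast)
qed

text \<open>Duality: a test function bounded by 1 pairs to at most the \<open>L1\<close> bound, but
  \<open>k\<close> stages produce a pairing of at least
  \<open>k * (\<eta>^3 * \<delta> / 8)\<close>. For large \<open>k\<close> this is impossible, so
  \<open>E\<close> is too small for the construction to run.\<close>

theorem weak_littlewood:
  fixes C \<delta> :: real
  assumes "0 < \<delta>"
  shows "\<exists>\<epsilon>>0. \<exists>N. \<forall>\<epsilon>' J c E. 0 < \<epsilon>' \<longrightarrow> \<epsilon>' \<le> \<epsilon> \<longrightarrow> admissible C \<delta> \<epsilon>' J c E \<longrightarrow> card E < N"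
proof -
  \<comment> \<open>Also covers nonpositive \<open>C\<close>, for which the choice of
    \<open>\<eta>\<close> below would fail.\<close>
  define C' where "C' = max C 1"
  define \<eta> where "\<eta> = min (1/2) (\<delta> / (8 * C'))"
  have "C' > 0" by (simp add: C'_def)
  then have \<eta>: "0 < \<eta>" "\<eta> \<le> 1/2" using assms by (auto simp: \<eta>_def)
  have "\<eta> * C' \<le> \<delta> / (8 * C') * C'" using \<open>C' > 0\<close> by (intro mult_right_mono) (auto simp: \<eta>_def)
  then have \<eta>C: "\<eta> * C' \<le> \<delta> / 8" using \<open>C' > 0\<close> by simp
  obtain M :: nat where "4 / \<eta>^2 < M" using reals_Archimedean2 by blast
  then have M: "4 \<le> \<eta>^2 * real M" "0 < M" using \<eta> by (auto simp: field_simps intro!: Nat.gr0I)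
  obtain k :: nat where "C' / (\<eta>^3 * \<delta> / 8) < k" using reals_Archimedean2 by blast
  then have k: "C' < k * (\<eta>^3 * \<delta> / 8)" using \<eta> assms by (simp add: field_simps)
  obtain \<epsilon> R a L where \<epsilon>: "\<epsilon> > 0" and F: "\<And>\<epsilon>' J c E. 0 < \<epsilon>' \<Longrightarrow> \<epsilon>' \<le> \<epsilon> \<Longrightarrow> admissible C' \<delta> \<epsilon>' J c E \<Longrightarrow>
      R \<le> card E \<Longrightarrow> has_test R a L (k * (\<eta>^3 * \<delta> / 8)) J c E"
    using test_functions[OF assms M(2) \<eta> M(1) \<eta>C, of k] by metis
  have "card E < R" if e: "0 < \<epsilon>'" "\<epsilon>' \<le> \<epsilon>" "admissible C \<delta> \<epsilon>' J c E" for \<epsilon>' J c E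
  proof (rule ccontr)
    assume "\<not> card E < R"
    moreover have adm: "admissible C' \<delta> \<epsilon>' J c E"
    proof -
      have "2 * pi * C \<le> 2 * pi * C'" by (intro mult_left_mono) (auto simp: C'_def)
      with e(3) show ?thesis unfolding admissible_def by (meson order_trans)
    qed
    ultimately have "has_test R a L (k * (\<eta>^3 * \<delta> / 8)) J c E"
      using F[OF e(1,2)] by simp
    then obtain A \<phi> where \<phi>: "tpoly A L \<phi>" "\<And>t. norm (\<phi> t) \<le> 1"
      "k * (\<eta>^3 * \<delta> / 8) \<le> Re (pairing (trig J c) \<phi>)"
      unfolding has_test_def by blast
    have "norm (pairing (trig J c) \<phi>) \<le> C'"
      using adm by (intro norm_pairing_le continuous_on_trig tpoly_continuous[OF \<phi>(1)] \<phi>(2)) (simp add: admissible_def)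
    then show False using \<phi>(3) k complex_Re_le_cmod[of "pairing (trig J c) \<phi>"] by linarith
  qed
  then show ?thesis using \<epsilon> by blast
qed

section \<open>Sign changes, recurrences and sine quotients\<close>

lemma no_zero_constant_sign:
  fixes f :: "real \<Rightarrow> real"
  assumes "continuous_on {a<..<b} f" "\<And>t. t \<in> {a<..<b} \<Longrightarrow> f t \<noteq> 0"
  shows "\<exists>\<sigma>\<in>{1, -1}. \<forall>t\<in>{a<..<b}. 0 < \<sigma> * f t"
proof (rule ccontr)
  assume neg: "\<not> ?thesis"
  have "\<exists>t\<in>{a<..<b}. f t < 0" "\<exists>t\<in>{a<..<b}. 0 < f t"
    using neg assms(2) by (auto simp: not_less le_less; force)+
  then obtain t u where tu: "t \<in> {a<..<b}" "u \<in> {a<..<b}" "f t < 0" "0 < f u" by blast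
  have "connected (f ` {a<..<b})" using assms(1) by (intro connected_continuous_image) auto
  then have "0 \<in> f ` {a<..<b}"
    using tu connectedD_interval[of "f ` {a<..<b}" "f t" "f u" 0] by auto
  then show False using assms(2) by auto
qed

text \<open>Induction by removing the largest zero \<open>z\<close>. If the sign flips at
  \<open>z\<close>, a factor with node \<open>z\<close> compensates, as cosine decreases on
  \<open>[0, pi]\<close>. Otherwise the node 0, whose factor is nonnegative everywhere, pads the
  list to length exactly \<open>k\<close>.\<close>

lemma few_zeros_sign:
  fixes f :: "real \<Rightarrow> real"
  assumes "continuous_on UNIV f" "0 < b" "b \<le> pi"
    and "finite {t\<in>{0<..<b}. f t = 0}" "card {t\<in>{0<..<b}. f t = 0} \<le> k"
  shows "\<exists>ys. length ys = k \<and> set ys \<subseteq> {0..b} \<and> (\<exists>\<sigma>\<in>{1, -1}. \<forall>t\<in>{0<..<b}.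
    0 \<le> \<sigma> * f t * (\<Prod>y\<leftarrow>ys. 2 * cos y - 2 * cos t))"
  using assms(2-)
proof (induction k arbitrary: b)
  case 0
  then have "\<And>t. t \<in> {0<..<b} \<Longrightarrow> f t \<noteq> 0" by auto
  then obtain \<sigma> where \<sigma>: "\<sigma> \<in> {1, -1}" "\<forall>t\<in>{0<..<b}. 0 < \<sigma> * f t"
    using no_zero_constant_sign[of 0 b f] continuous_on_subset[OF assms(1)] by blast
  show ?case
    by (intro exI[of _ "[]"] conjI bexI[OF _ \<sigma>(1)]) (use \<sigma>(2) in \<open>auto intro: less_imp_le\<close>)
next
  case (Suc k)
  define Z where "Z = {t\<in>{0<..<b}. f t = 0}"
  have Z: "finite Z" "card Z \<le> Suc k" using Suc.prems by (simp_all add: Z_def)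
  have pad: "0 \<le> 2 * cos 0 - 2 * cos t" for t :: real by simp
  show ?case
  proof (cases "card Z \<le> k")
    case True
    then obtain ys \<sigma> where ys: "length ys = k" "set ys \<subseteq> {0..b}" "\<sigma> \<in> {1, -1}"
      "\<And>t. t \<in> {0<..<b} \<Longrightarrow> 0 \<le> \<sigma> * f t * (\<Prod>y\<leftarrow>ys. 2 * cos y - 2 * cos t)"
      using Suc.IH[of b] Suc.prems unfolding Z_def by blast
    have "0 \<le> \<sigma> * f t * (\<Prod>y\<leftarrow>0 # ys. 2 * cos y - 2 * cos t)" if "t \<in> {0<..<b}" for t
      using mult_nonneg_nonneg[OF pad ys(4)[OF that], of t] by (simp add: mult_ac)
    then show ?thesis using ys Suc.prems by (intro exI[of _ "0 # ys"]) auto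
  next
    case False
    then have "Z \<noteq> {}" by auto
    define z where "z = Max Z"
    have z: "z \<in> Z" "\<And>t. t \<in> Z \<Longrightarrow> t \<le> z" using Z \<open>Z \<noteq> {}\<close> by (auto simp: z_def)
    then have z0: "0 < z" "z < b" "f z = 0" by (auto simp: Z_def)
    have "{t\<in>{0<..<z}. f t = 0} = Z - {z}" using z z0 by (force simp: Z_def)
    then have "finite {t\<in>{0<..<z}. f t = 0}" "card {t\<in>{0<..<z}. f t = 0} \<le> k"
      using Z z by auto
    then obtain ys \<sigma> where ys: "length ys = k" "set ys \<subseteq> {0..z}" "\<sigma> \<in> {1, -1}"
      "\<And>t. t \<in> {0<..<z} \<Longrightarrow> 0 \<le> \<sigma> * f t * (\<Prod>y\<leftarrow>ys. 2 * cos y - 2 * cos t)"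
      using Suc.IH[of z] z0(1,2) Suc.prems(2) by (meson less_imp_le order_trans)
    have "f t \<noteq> 0" if "t \<in> {z<..<b}" for t
    proof -
      have "t \<notin> Z" using z(2) that by force
      then show ?thesis using that z0 by (auto simp: Z_def)
    qed
    then obtain \<tau> where \<tau>: "\<tau> \<in> {1, -1}" "\<And>t. t \<in> {z<..<b} \<Longrightarrow> 0 < \<tau> * f t"
      using no_zero_constant_sign[of z b f] continuous_on_subset[OF assms(1)] by blast
    have right: "0 \<le> 2 * cos y - 2 * cos t" if "y \<in> {0..z}" "t \<in> {z<..<b}" for y t
      using that Suc.prems by (auto intro!: cos_monotone_0_pi_le)
    have left: "2 * cos z - 2 * cos t \<le> 0" if "t \<in> {0<..<z}" for t
      using that z0 Suc.prems by (auto intro!: cos_monotone_0_pi_le)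
    have prod_right: "0 \<le> (\<Prod>y\<leftarrow>ys. 2 * cos y - 2 * cos t)" if "t \<in> {z<..<b}" for t
      using ys(2) right[OF _ that] by (induction ys) auto
    \<comment> \<open>\<open>\<sigma>\<close> is the sign that works left of \<open>z\<close>,
      \<open>\<tau>\<close> the sign of \<open>f\<close> right of \<open>z\<close>; right of
      \<open>z\<close> all factors are nonnegative, so \<open>\<tau>\<close> is the sign to be
      kept.\<close>
    define y0 where "y0 = (if \<tau> = \<sigma> then 0 else z)"
    have main: "0 \<le> \<tau> * f t * (\<Prod>y\<leftarrow>y0 # ys. 2 * cos y - 2 * cos t)" if t: "t \<in> {0<..<b}" for t
    proof -
      consider "t \<in> {0<..<z}" | "t = z" | "t \<in> {z<..<b}"
        using t by (cases t z rule: linorder_cases) auto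
      then show ?thesis
      proof cases
        case 1
        show ?thesis
        proof (cases "\<tau> = \<sigma>")
          case True
          then show ?thesis using mult_nonneg_nonneg[OF pad ys(4)[OF 1], of t] by (simp add: y0_def mult_ac)
        next
          case False
          then have "\<tau> = - \<sigma>" using \<tau>(1) ys(3) by auto
          then show ?thesis
            using mult_nonpos_nonneg[OF left[OF 1] ys(4)[OF 1]] False by (simp add: y0_def mult_ac)
        qed
      next
        case 2
        then show ?thesis using z0 by simp
      next
        case 3
        have "0 \<le> 2 * cos y0 - 2 * cos t" using right[OF _ 3, of y0] z0 by (auto simp: y0_def)
        then have "0 \<le> (\<tau> * f t) * ((2 * cos y0 - 2 * cos t) * (\<Prod>y\<leftarrow>ys. 2 * cos y - 2 * cos t))"
          by (intro mult_nonneg_nonneg[of "\<tau> * f t"] mult_nonneg_nonneg[OF _ prod_right[OF 3]]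
              less_imp_le[OF \<tau>(2)[OF 3]])
        then show ?thesis by simp
      qed
    qed
    show ?thesis
      by (intro exI[of _ "y0 # ys"] conjI bexI[OF _ \<tau>(1)]) (use ys z0 main in \<open>auto simp: y0_def\<close>)
  qed
qed

text \<open>The zeros cut the interval into at most \<open>k + 1\<close> pieces of constant sign; on
  each the integral of the absolute value is the absolute value of the integral.\<close>

lemma integral_abs_few_zeros:
  fixes f :: "real \<Rightarrow> real"
  assumes "continuous_on UNIV f" "a \<le> b"
    and "finite {t\<in>{a<..<b}. f t = 0}" "card {t\<in>{a<..<b}. f t = 0} \<le> k"
    and \<kappa>: "\<And>x y. a \<le> x \<Longrightarrow> x \<le> y \<Longrightarrow> y \<le> b \<Longrightarrow> \<bar>integral {x..y} f\<bar> \<le> \<kappa>"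
  shows "integral {a..b} (\<lambda>t. \<bar>f t\<bar>) \<le> (real k + 1) * \<kappa>"
proof -
  have cont: "continuous_on S f" for S using assms(1) continuous_on_subset by blast
  have piece: "integral {x..y} (\<lambda>t. \<bar>f t\<bar>) \<le> \<kappa>"
    if xy: "a \<le> x" "x \<le> y" "y \<le> b" and nz: "\<And>t. t \<in> {x<..<y} \<Longrightarrow> f t \<noteq> 0" for x y
  proof -
    obtain \<sigma> where \<sigma>: "\<sigma> \<in> {1, -1}" "\<And>t. t \<in> {x<..<y} \<Longrightarrow> 0 < \<sigma> * f t"
      using no_zero_constant_sign[of x y f] cont nz by blast
    have "integral {x..y} (\<lambda>t. \<bar>f t\<bar>) = integral {x..y} (\<lambda>t. \<sigma> * f t)"
    proof (rule integral_spike[of "{x, y}"])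
      fix t assume "t \<in> {x..y} - {x, y}"
      then have "0 < \<sigma> * f t" by (intro \<sigma>(2)) auto
      then show "\<sigma> * f t = \<bar>f t\<bar>" using \<sigma>(1) by auto
    qed (simp add: negligible_insert)
    also have "\<dots> = \<sigma> * integral {x..y} f" by simp
    also have "\<dots> \<le> \<kappa>" using \<kappa>[OF xy] \<sigma>(1) by auto
    finally show ?thesis .
  qed
  have "0 \<le> \<kappa>" using \<kappa>[of a a] \<open>a \<le> b\<close> by simp
  have "integral {a..b'} (\<lambda>t. \<bar>f t\<bar>) \<le> (real k + 1) * \<kappa>"
    if "a \<le> b'" "b' \<le> b" "finite {t\<in>{a<..<b'}. f t = 0}" "card {t\<in>{a<..<b'}. f t = 0} \<le> k" for b' k
    using that
  proof (induction k arbitrary: b')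
    case 0
    then have "integral {a..b'} (\<lambda>t. \<bar>f t\<bar>) \<le> \<kappa>" by (intro piece) auto
    then show ?case by simp
  next
    case (Suc k)
    define Z where "Z = {t\<in>{a<..<b'}. f t = 0}"
    have Z: "finite Z" "card Z \<le> Suc k" using Suc.prems by (simp_all add: Z_def)
    show ?case
    proof (cases "Z = {}")
      case True
      then have "integral {a..b'} (\<lambda>t. \<bar>f t\<bar>) \<le> 1 * \<kappa>"
        using Suc.prems piece[of a b'] by (auto simp: Z_def)
      also have "\<dots> \<le> (real (Suc k) + 1) * \<kappa>" using \<open>0 \<le> \<kappa>\<close> by (intro mult_right_mono) auto
      finally show ?thesis .
    next
      case False
      define z where "z = Max Z"
      have z: "z \<in> Z" "\<And>t. t \<in> Z \<Longrightarrow> t \<le> z" using Z False by (auto simp: z_def)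
      then have z0: "a < z" "z < b'" by (auto simp: Z_def)
      have "{t\<in>{a<..<z}. f t = 0} = Z - {z}" using z z0 by (force simp: Z_def)
      then have "finite {t\<in>{a<..<z}. f t = 0}" "card {t\<in>{a<..<z}. f t = 0} \<le> k"
        using Z z by auto
      then have "integral {a..z} (\<lambda>t. \<bar>f t\<bar>) \<le> (real k + 1) * \<kappa>"
        using Suc.IH[of z] z0 Suc.prems by auto
      moreover have "integral {z..b'} (\<lambda>t. \<bar>f t\<bar>) \<le> \<kappa>"
      proof (rule piece)
        fix t assume t: "t \<in> {z<..<b'}"
        then have "t \<notin> Z" using z(2) by force
        then show "f t \<noteq> 0" using t z0 by (auto simp: Z_def)
      qed (use z0 Suc.prems in auto)
      moreover have "integral {a..z} (\<lambda>t. \<bar>f t\<bar>) + integral {z..b'} (\<lambda>t. \<bar>f t\<bar>) = integral {a..b'} (\<lambda>t. \<bar>f t\<bar>)"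
        using z0 by (intro Henstock_Kurzweil_Integration.integral_combine integrable_continuous_interval continuous_intros cont) auto
      ultimately show ?thesis by (simp add: algebra_simps)
    qed
  qed
  then show ?thesis using assms by blast
qed

text \<open>Each factor is \<open>2 cos y\<close> minus two exponentials. So the lowest coefficient
  is 1 or -1, which keeps a limit of such polynomials nondegenerate, and each factor enlarges
  coefficients at most fourfold, which gives compactness.\<close>

lemma cos_prod_trig:
  "\<exists>q :: int \<Rightarrow> real. (\<forall>t. complex_of_real (\<Prod>y\<leftarrow>ys. 2 * cos y - 2 * cos t)
      = trig {- int (length ys)..int (length ys)} (\<lambda>i. of_real (q i)) t) \<and>
    (\<forall>i. int (length ys) < \<bar>i\<bar> \<longrightarrow> q i = 0) \<and> \<bar>q (- int (length ys))\<bar> = 1 \<and>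
    (\<forall>i. \<bar>q i\<bar> \<le> 4 ^ length ys)"
proof (induction ys)
  case Nil
  show ?case by (intro exI[of _ "\<lambda>i. if i = 0 then 1 else 0"]) (auto simp: trig_def)
next
  case (Cons y ys)
  define k where "k = int (length ys)"
  obtain q :: "int \<Rightarrow> real" where q: "\<And>t. complex_of_real (\<Prod>y\<leftarrow>ys. 2 * cos y - 2 * cos t)
      = trig {- k..k} (\<lambda>i. of_real (q i)) t" "\<And>i. k < \<bar>i\<bar> \<Longrightarrow> q i = 0" "\<bar>q (- k)\<bar> = 1"
    "\<And>i. \<bar>q i\<bar> \<le> 4 ^ length ys"
    using Cons.IH unfolding k_def by blast
  define e :: "int \<Rightarrow> complex" where "e i = (if i = 0 then of_real (2 * cos y) else -1)" for i
  define q' where "q' m = 2 * cos y * q m - q (m - 1) - q (m + 1)" for m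
  have I: "{-1..1::int} = {-1, 0, 1}" by auto
  have e: "complex_of_real (2 * cos y - 2 * cos t) = trig {-1..1} e t" for t
    unfolding I by (simp add: trig_def e_def complex_eq_iff)
  have "complex_of_real (\<Prod>y\<leftarrow>y # ys. 2 * cos y - 2 * cos t) = trig {-(k + 1)..k + 1} (\<lambda>i. of_real (q' i)) t" for t
  proof -
    have "complex_of_real (\<Prod>y\<leftarrow>y # ys. 2 * cos y - 2 * cos t) = trig {-1..1} e t * trig {- k..k} (\<lambda>i. of_real (q i)) t"
      by (simp add: q(1)[symmetric] e[symmetric])
    also have "\<dots> = trig {-(k + 1)..k + 1} (\<lambda>m. \<Sum>i\<in>{-1..1}. e i * of_real (q (m - i))) t"
      by (rule trig_mult) (use q(2) in auto)
    also have "(\<lambda>m. \<Sum>i\<in>{-1..1}. e i * of_real (q (m - i))) = (\<lambda>m. complex_of_real (q' m))"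
      unfolding I by (rule ext) (simp add: e_def q'_def)
    finally show ?thesis .
  qed
  moreover have "q' i = 0" if "k + 1 < \<bar>i\<bar>" for i
    using that q(2)[of i] q(2)[of "i - 1"] q(2)[of "i + 1"] by (simp add: q'_def)
  moreover have "\<bar>q' (-(k + 1))\<bar> = 1"
    using q(2)[of "-(k + 1)"] q(2)[of "-(k + 1) - 1"] q(3) by (simp add: q'_def k_def)
  moreover have "\<bar>q' i\<bar> \<le> 4 ^ length (y # ys)" for i
  proof -
    have "\<bar>2 * cos y * q i\<bar> \<le> 2 * 4 ^ length ys"
      unfolding abs_mult using q(4)[of i] abs_cos_le_one[of y] by (intro mult_mono) auto
    then show ?thesis using q(4)[of "i - 1"] q(4)[of "i + 1"] by (simp add: q'_def)
  qed
  moreover have len: "int (length (y # ys)) = k + 1" by (simp add: k_def)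
  ultimately show ?case unfolding len by blast
qed

section \<open>Finite-valued sequences satisfying a recurrence\<close>

text \<open>
  A finite-valued sequence has finitely many states of length \<open>2 k\<close>, so the recurrence makes it
  periodic with period at most the number \<open>p\<close> of states; \<open>p!\<close> is a period common to all stretches.
\<close>
lemma recurrence_periodic:
  fixes q :: "int \<Rightarrow> real" and k :: nat and V :: "real set"
  assumes "finite V" "q (- int k) \<noteq> 0"
  shows "\<exists>P\<ge>1. \<exists>w\<ge>0. \<forall>b E u. range b \<subseteq> V \<longrightarrow> (\<forall>j. j \<notin> E \<longrightarrow> (\<Sum>i\<in>{- int k..int k}. q i * b (j - i)) = 0) \<longrightarrow>
    E \<inter> {u - w..u + w} = {} \<longrightarrow> b (u + int P) = b u"
proof -
  define I where "I = {- int k..<int k}"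
  define St where "St = PiE I (\<lambda>_. V)"
  have "finite St" unfolding St_def I_def using assms by (intro finite_PiE) auto
  define p where "p = card St"
  define P :: nat where "P = fact p"
  \<comment> \<open>The recurrence is used at positions from \<open>u - p\<close> up to
    \<open>u + P + p\<close>; this radius covers them all.\<close>
  define w where "w = int p + int P + int k"
  have "b (u + int P) = b u"
    if V: "range b \<subseteq> V" and rec: "\<And>j. j \<notin> E \<Longrightarrow> (\<Sum>i\<in>{- int k..int k}. q i * b (j - i)) = 0"
      and E: "E \<inter> {u - w..u + w} = {}" for b E u
  proof -
    define st where "st j = restrict (\<lambda>i. b (j + i)) I" for j
    \<comment> \<open>Pigeonhole: \<open>p + 1\<close> positions, but only \<open>p\<close>
      states.\<close>
    have "\<not> inj_on st {u - int p..u}"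
    proof
      assume "inj_on st {u - int p..u}"
      moreover have "st ` {u - int p..u} \<subseteq> St" using V by (auto simp: st_def St_def)
      ultimately have "card {u - int p..u} \<le> p"
        using card_inj_on_le \<open>finite St\<close> unfolding p_def by blast
      then show False by simp
    qed
    then obtain x y where xy: "x \<in> {u - int p..u}" "y \<in> {u - int p..u}" "x < y" "st x = st y"
      unfolding inj_on_def by (metis linorder_neqE)
    define d where "d = y - x"
    have same: "b (x + i + d) = b (x + i)" if "i \<in> I" for i
      using fun_cong[OF xy(4), of i] that by (simp add: st_def d_def algebra_simps)
    \<comment> \<open>Positions are counted from \<open>x - k\<close>, the left end of the state at
      \<open>x\<close>. The first \<open>2 * k\<close> agree with their shifts by \<open>d\<close>
      because the states do; afterwards the recurrences at \<open>j\<close> and \<open>j + d\<close>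
      determine the next value, as \<open>q (- k)\<close> is nonzero.\<close>
    have per: "x + (int n - int k) \<le> u + int P \<Longrightarrow> b (x + (int n - int k) + d) = b (x + (int n - int k))" for n :: nat
    proof (induction n rule: less_induct)
      case (less n)
      show ?case
      proof (cases "n < 2 * k")
        case True
        then show ?thesis by (intro same) (auto simp: I_def)
      next
        case False
        define v where "v = x + (int n - int k)"
        have vk: "x \<le> v - int k" "v \<le> u + int P" using False less.prems by (auto simp: v_def)
        define j where "j = v - int k"
        have j: "j \<notin> E" "j + d \<notin> E"
          using E vk xy by (auto simp: j_def w_def d_def disjoint_iff)
        have split: "(\<Sum>i\<in>{- int k..int k}. q i * b (j' - i)) = q (- int k) * b (j' + int k)
           + (\<Sum>i\<in>{- int k + 1..int k}. q i * b (j' - i))" for j'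
        proof -
          have "{- int k..int k} = insert (- int k) {- int k + 1..int k}" by auto
          then show ?thesis by simp
        qed
        have "(\<Sum>i\<in>{- int k + 1..int k}. q i * b (j + d - i)) = (\<Sum>i\<in>{- int k + 1..int k}. q i * b (j - i))"
        proof (intro sum.cong refl)
          fix i assume i: "i \<in> {- int k + 1..int k}"
          define n' where "n' = nat (j - i - x + int k)"
          have n': "int n' = j - i - x + int k" using i vk by (simp add: n'_def j_def)
          have "n' < n" using n' i by (simp add: j_def v_def)
          moreover have "x + (int n' - int k) = j - i" using n' by simp
          moreover have "j - i \<le> u + int P" using i vk by (simp add: j_def)
          ultimately have "b (j - i + d) = b (j - i)" using less.IH[of n'] by simp
          then show "q i * b (j + d - i) = q i * b (j - i)" by (simp add: algebra_simps)
        qed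
        then have "q (- int k) * b (j + d + int k) = q (- int k) * b (j + int k)"
          using rec[OF j(1)] rec[OF j(2)] unfolding split by linarith
        then have "b (v + d) = b v" using assms(2) by (simp add: j_def algebra_simps)
        then show ?thesis by (simp add: v_def)
      qed
    qed
    have per': "b (v + d) = b v" if "x \<le> v" "v \<le> u + int P" for v
      using per[of "nat (v - x + int k)"] that by simp
    \<comment> \<open>The last step of length \<open>d\<close> may still start at
      \<open>u + P\<close>, hence the slack \<open>d\<close> in the bound.\<close>
    have mult: "u + int m * d \<le> u + int P + d \<Longrightarrow> b (u + int m * d) = b u" for m :: nat
    proof (induction m)
      case 0
      then show ?case by simp
    next
      case (Suc m)
      have le: "u + int m * d \<le> u + int P" using Suc.prems by (simp add: algebra_simps)
      have "0 \<le> int m * d" using xy by (simp add: d_def)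
      then have "b (u + int m * d + d) = b (u + int m * d)" using le xy by (intro per') auto
      moreover have "b (u + int m * d) = b u" using Suc.IH le xy by (simp add: d_def)
      ultimately show ?case by (simp add: algebra_simps)
    qed
    have "nat d dvd P" unfolding P_def using xy by (intro dvd_fact) (auto simp: d_def)
    then obtain m where "P = nat d * m" by (elim dvdE)
    then have "int P = int m * d" using xy by (simp add: d_def)
    then show ?thesis using mult[of m] xy by (simp add: d_def)
  qed
  moreover have "P \<ge> 1" by (simp add: P_def)
  moreover have "w \<ge> 0" by (simp add: w_def)
  ultimately show ?thesis by blast
qed

lemma card_break_points:
  fixes b :: "int \<Rightarrow> real"
  assumes "finite E" "card E \<le> N" "0 \<le> w"
    and per: "\<And>u. E \<inter> {u - w..u + w} = {} \<Longrightarrow> b (u + p) = b u"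
  shows "card {u. b (u + p) \<noteq> b u} \<le> N * nat (2 * w + 1)"
proof -
  have sub: "{u. b (u + p) \<noteq> b u} \<subseteq> (\<Union>e\<in>E. {e - w..e + w})"
  proof
    fix u assume "u \<in> {u. b (u + p) \<noteq> b u}"
    then obtain e where "e \<in> E" "e \<in> {u - w..u + w}" using per[of u] by blast
    then show "u \<in> (\<Union>e\<in>E. {e - w..e + w})" by (intro UN_I[of e]) auto
  qed
  have "card {u. b (u + p) \<noteq> b u} \<le> card (\<Union>e\<in>E. {e - w..e + w})"
    using sub assms(1) by (intro card_mono) auto
  also have "\<dots> \<le> (\<Sum>e\<in>E. card {e - w..e + w})" using assms(1) by (rule card_UN_le)
  also have "\<dots> = card E * nat (2 * w + 1)" by (simp add: algebra_simps)
  also have "\<dots> \<le> N * nat (2 * w + 1)" using assms by simp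
  finally show ?thesis .
qed

section \<open>Integrals of sine quotients\<close>

lemma sin_ge_half:
  fixes x :: real
  assumes "0 \<le> x" "x \<le> pi / 3"
  shows "x / 2 \<le> sin x"
proof -
  have "sin 0 - 0 / 2 \<le> sin x - x / 2"
  proof (rule DERIV_nonneg_imp_nondecreasing[OF assms(1)])
    fix t assume t: "0 \<le> t" "t \<le> x"
    have "cos (pi / 3) \<le> cos t" using t assms pi_gt_zero by (intro cos_monotone_0_pi_le) auto
    then have "0 \<le> cos t - 1 / 2" by (simp add: cos_60)
    moreover have "((\<lambda>t. sin t - t / 2) has_real_derivative cos t - 1 / 2) (at t)"
      by (auto intro!: derivative_eq_intros)
    ultimately show "\<exists>y. ((\<lambda>t. sin t - t / 2) has_real_derivative y) (at t) \<and> 0 \<le> y" by blast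
  qed
  then show ?thesis by simp
qed

lemma integral_sin_bound:
  fixes u x y :: real
  assumes "0 < u" "x \<le> y"
  shows "\<bar>integral {x..y} (\<lambda>t. sin (u * t))\<bar> \<le> 2 / u"
proof -
  have "((\<lambda>t. sin (u * t)) has_integral (- cos (u * y) / u - (- cos (u * x) / u))) {x..y}"
  proof (rule fundamental_theorem_of_calculus[OF assms(2)])
    fix t
    have "((\<lambda>t. - cos (u * t) / u) has_real_derivative sin (u * t)) (at t within {x..y})"
      using assms by (auto intro!: derivative_eq_intros)
    then show "((\<lambda>t. - cos (u * t) / u) has_vector_derivative sin (u * t)) (at t within {x..y})"
      by (simp add: has_real_derivative_iff_has_vector_derivative)
  qed
  then have "integral {x..y} (\<lambda>t. sin (u * t)) = (cos (u * x) - cos (u * y)) / u"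
    by (simp add: integral_unique diff_divide_distrib)
  moreover have "\<bar>cos (u * x) - cos (u * y)\<bar> \<le> 2"
    using abs_cos_le_one[of "u * x"] abs_cos_le_one[of "u * y"] by linarith
  ultimately show ?thesis using assms by (simp add: divide_right_mono)
qed

text \<open>The bound must not depend on \<open>u\<close>. Up to \<open>1 / u\<close> the integrand
  is at most \<open>4 * u\<close>, which contributes at most 4. Beyond \<open>1 / u\<close> the
  reciprocal sine is monotone and at most \<open>4 * u\<close>, while integrals of
  \<open>sin (u * t)\<close> are at most \<open>2 / u\<close>; the second mean value theorem gives
  two terms of size at most 8.\<close>

lemma integral_sin_quotient_bound_pos:
  fixes u p :: real
  assumes "0 < u" "1 \<le> p" "0 < x" "x \<le> y" "y \<le> pi / (2 * p)"
  shows "\<bar>integral {x..y} (\<lambda>t. sin (u * t) / sin (p * t / 2))\<bar> \<le> 20"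
proof -
  have bd: "t / 4 \<le> sin (p * t / 2)" "0 < sin (p * t / 2)" if "0 < t" "t \<le> pi / (2 * p)" for t
  proof -
    have "p * t / 2 \<le> pi / 4" using that assms by (simp add: field_simps)
    then have "p * t / 2 \<le> pi / 3" using pi_gt_zero by linarith
    then have "p * t / 2 / 2 \<le> sin (p * t / 2)" using that assms by (intro sin_ge_half) auto
    moreover have "t \<le> p * t" using assms that by simp
    ultimately show "t / 4 \<le> sin (p * t / 2)" by linarith
    then show "0 < sin (p * t / 2)" using that by linarith
  qed
  have int: "(\<lambda>t. sin (u * t) / sin (p * t / 2)) integrable_on {a..b}" if "0 < a" "b \<le> pi / (2 * p)" for a b
    using bd(2) that by (intro integrable_continuous_interval continuous_intros) (auto simp: less_imp_neq[symmetric])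
  have near: "\<bar>integral {a..b} (\<lambda>t. sin (u * t) / sin (p * t / 2))\<bar> \<le> 4"
    if ab: "0 < a" "a \<le> b" "b \<le> pi / (2 * p)" "b \<le> 1 / u" for a b
  proof -
    have "norm (integral (cbox a b) (\<lambda>t. sin (u * t) / sin (p * t / 2))) \<le> 4 * u * measure lborel (cbox a b)"
    proof (rule integrable_bound)
      fix t assume "t \<in> cbox a b"
      then have t: "0 < t" "t \<le> pi / (2 * p)" using ab by auto
      have "\<bar>sin (u * t)\<bar> \<le> u * t" using abs_sin_x_le_abs_x[of "u * t"] t assms by simp
      then have "\<bar>sin (u * t)\<bar> / sin (p * t / 2) \<le> (u * t) / (t / 4)"
        using bd[OF t] t assms by (intro frac_le) auto
      then show "norm (sin (u * t) / sin (p * t / 2)) \<le> 4 * u" using bd[OF t] t by simp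
    qed (use assms int[OF ab(1,3)] in auto)
    also have "\<dots> \<le> 4 * u * (1 / u)" using ab assms by (intro mult_left_mono) auto
    finally show ?thesis using assms by simp
  qed
  have far: "\<bar>integral {a..b} (\<lambda>t. sin (u * t) / sin (p * t / 2))\<bar> \<le> 16"
    if ab: "1 / u \<le> a" "a \<le> b" "b \<le> pi / (2 * p)" for a b
  proof -
    have "0 < a" using ab assms by (meson divide_pos_pos less_le_trans zero_less_one)
    \<comment> \<open>The minus sign turns the decreasing reciprocal into the increasing function
      that the second mean value theorem expects.\<close>
    have mono: "- (1 / sin (p * s / 2)) \<le> - (1 / sin (p * t / 2))" if "a \<le> s" "s \<le> t" "t \<le> b" for s t
    proof -
      have "t \<le> pi / (2 * p)" using that ab by linarith
      then have "2 * (p * t) \<le> pi" using assms by (simp add: field_simps)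
      then have "p * t / 2 \<le> pi / 2" using pi_gt_zero by linarith
      then have "sin (p * s / 2) \<le> sin (p * t / 2)"
        using that \<open>0 < a\<close> assms by (intro sin_monotone_2pi_le) (auto intro: order_trans[of _ 0])
      then show ?thesis using bd(2)[of s] that ab \<open>0 < a\<close> by (simp add: frac_le)
    qed
    have isin: "(\<lambda>t. sin (u * t)) integrable_on {a..b}"
      by (intro integrable_continuous_interval continuous_intros)
    obtain c where c: "c \<in> {a..b}" "integral {a..b} (\<lambda>t. - (1 / sin (p * t / 2)) * sin (u * t))
        = - (1 / sin (p * a / 2)) * integral {a..c} (\<lambda>t. sin (u * t)) + - (1 / sin (p * b / 2)) * integral {c..b} (\<lambda>t. sin (u * t))"
      using second_mean_value_theorem[OF isin ab(2), of "\<lambda>t. - (1 / sin (p * t / 2))"] mono by blast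
    have g: "\<bar>- (1 / sin (p * t / 2))\<bar> \<le> 4 * u" if "t \<in> {a..b}" for t
    proof -
      have t: "0 < t" "t \<le> pi / (2 * p)" "1 / u \<le> t" using that ab \<open>0 < a\<close> by auto
      have "1 / sin (p * t / 2) \<le> 1 / (1 / u / 4)"
        using bd[OF t(1,2)] t assms by (intro divide_left_mono) auto
      then show ?thesis using bd[OF t(1,2)] by simp
    qed
    have "\<bar>- (1 / sin (p * a / 2)) * integral {a..c} (\<lambda>t. sin (u * t))\<bar> \<le> 4 * u * (2 / u)"
      unfolding abs_mult using g[of a] integral_sin_bound[OF assms(1), of a c] c(1) ab assms
      by (intro mult_mono) auto
    moreover have "\<bar>- (1 / sin (p * b / 2)) * integral {c..b} (\<lambda>t. sin (u * t))\<bar> \<le> 4 * u * (2 / u)"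
      unfolding abs_mult using g[of b] integral_sin_bound[OF assms(1), of c b] c(1) ab assms
      by (intro mult_mono) auto
    moreover have "4 * u * (2 / u) = 8" using assms by simp
    ultimately have "\<bar>integral {a..b} (\<lambda>t. - (1 / sin (p * t / 2)) * sin (u * t))\<bar> \<le> 16"
      unfolding c(2) by linarith
    moreover have "(\<lambda>t. - (1 / sin (p * t / 2)) * sin (u * t)) = (\<lambda>t. - (sin (u * t) / sin (p * t / 2)))" by auto
    ultimately show ?thesis by simp
  qed
  consider "y \<le> 1 / u" | "1 / u \<le> x" | "x < 1 / u" "1 / u < y" by linarith
  then show ?thesis
  proof cases
    case 1
    then show ?thesis using near[of x y] assms by simp
  next
    case 2
    then show ?thesis using far[of x y] assms by simp
  next
    case 3
    have "integral {x..1 / u} (\<lambda>t. sin (u * t) / sin (p * t / 2)) + integral {1 / u..y} (\<lambda>t. sin (u * t) / sin (p * t / 2))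
        = integral {x..y} (\<lambda>t. sin (u * t) / sin (p * t / 2))"
      using 3 assms by (intro Henstock_Kurzweil_Integration.integral_combine int) auto
    then show ?thesis using near[of x "1 / u"] far[of "1 / u" y] 3 assms by linarith
  qed
qed

lemma integral_sin_quotient_bound:
  fixes u p :: real
  assumes "1 \<le> p" "0 < x" "x \<le> y" "y \<le> pi / (2 * p)"
  shows "\<bar>integral {x..y} (\<lambda>t. sin (u * t) / sin (p * t / 2))\<bar> \<le> 20"
proof -
  consider "u = 0" | "0 < u" | "0 < - u" by linarith
  then show ?thesis
  proof cases
    case 3
    then show ?thesis using integral_sin_quotient_bound_pos[OF 3 assms] by simp
  qed (use integral_sin_quotient_bound_pos assms in auto)
qed

section \<open>Cosine polynomials with few zeros\<close>

text \<open>The two-sided Fourier coefficients, extended by 0 to all integers so that shifts and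
  convolutions are always defined.\<close>

definition sym_coeff :: "(nat \<Rightarrow> real) \<Rightarrow> nat \<Rightarrow> int \<Rightarrow> real" where
  "sym_coeff c n j = (if int n < \<bar>j\<bar> then 0 else if j = 0 then c 0 else c (nat \<bar>j\<bar>) / 2)"

lemma cos_poly_trig:
  "complex_of_real (cos_poly c n t) = trig {- int n..int n} (\<lambda>j. of_real (sym_coeff c n j)) t"
proof -
  define s where "s j = complex_of_real (if j = 0 then c 0 else c (nat \<bar>j\<bar>) / 2)" for j :: int
  have "complex_of_real (cos_poly c n t) = (\<Sum>j\<in>{- int n..int n}. s j * cis (of_int j * t))"
  proof (induction n)
    case 0
    then show ?case by (simp add: cos_poly_def s_def)
  next
    case (Suc n)
    have "{- int (Suc n)..int (Suc n)} = insert (int (Suc n)) (insert (- int (Suc n)) {- int n..int n})"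
      by auto
    then have "(\<Sum>j\<in>{- int (Suc n)..int (Suc n)}. s j * cis (of_int j * t))
        = s (int (Suc n)) * cis (real (Suc n) * t) + (s (- int (Suc n)) * cis (- real (Suc n) * t)
          + complex_of_real (cos_poly c n t))"
      by (simp add: Suc.IH)
    also have "\<dots> = complex_of_real (c (Suc n) / 2) * cis (real (Suc n) * t)
        + (complex_of_real (c (Suc n) / 2) * cis (- real (Suc n) * t) + complex_of_real (cos_poly c n t))"
      by (simp add: s_def nat_add_distrib)
    also have "\<dots> = complex_of_real (cos_poly c (Suc n) t)"
      by (simp only: cos_poly_def mult_minus_left) (simp add: complex_eq_iff del: of_nat_Suc)
    finally show ?case by simp
  qed
  then show ?thesis by (auto simp: trig_def s_def sym_coeff_def intro!: sum.cong)
qed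

lemma continuous_on_cos_poly [continuous_intros]: "continuous_on S (cos_poly c n)"
  unfolding cos_poly_def[abs_def] by (intro continuous_intros)

lemma cos_poly_minus [simp]: "cos_poly c n (- t) = cos_poly c n t"
  by (simp add: cos_poly_def)

lemma cos_poly_periodic: "cos_poly c n (t - 2 * pi * of_int m) = cos_poly c n t"
proof -
  have "cos (real j * (t - 2 * pi * of_int m)) = cos (real j * t)" for j
  proof -
    have "real j * (t - 2 * pi * of_int m) = real j * t - 2 * pi * of_int (int j * m)"
      by (simp add: algebra_simps)
    then show ?thesis by (simp only: cos_diff cos_int_2pin sin_int_2pin)
  qed
  then show ?thesis by (simp add: cos_poly_def)
qed

text \<open>Multiplicities and the endpoints are ignored: only sign changes in the open interval
  matter, and evenness and continuity take care of the rest of the period.\<close>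

definition few_zeros :: "nat \<Rightarrow> (real \<Rightarrow> real) \<Rightarrow> bool" where
  "few_zeros k f \<longleftrightarrow> finite {t\<in>{0<..<pi}. f t = 0} \<and> card {t\<in>{0<..<pi}. f t = 0} \<le> k"

text \<open>The corrected product is nonnegative, so its \<open>L1\<close> norm is
  \<open>2 * pi * d 0\<close>, and \<open>d 0\<close> has \<open>2 * k + 1\<close> summands of size
  at most \<open>4 ^ k * B\<close>.\<close>

lemma few_zeros_product:
  assumes fz: "few_zeros k (cos_poly c n)" and B: "\<And>j. \<bar>sym_coeff c n j\<bar> \<le> B"
  shows "\<exists>q :: int \<Rightarrow> real. \<bar>q (- int k)\<bar> = 1 \<and> (\<forall>i. \<bar>q i\<bar> \<le> 4 ^ k) \<and>
    (\<forall>i. int k < \<bar>i\<bar> \<longrightarrow> q i = 0) \<and>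
    integral {-pi..pi} (\<lambda>t. norm (trig {- int (n + k)..int (n + k)}
      (\<lambda>m. of_real (\<Sum>i\<in>{- int k..int k}. q i * sym_coeff c n (m - i))) t)) \<le> 2 * pi * ((2 * real k + 1) * 4 ^ k * B)"
proof -
  let ?T = "cos_poly c n" and ?b = "sym_coeff c n" and ?K = "{- int (n + k)..int (n + k)}"
  obtain ys \<sigma> where ys: "length ys = k" "\<sigma> \<in> {1, -1}"
    "\<And>t. t \<in> {0<..<pi} \<Longrightarrow> 0 \<le> \<sigma> * ?T t * (\<Prod>y\<leftarrow>ys. 2 * cos y - 2 * cos t)"
    using few_zeros_sign[OF continuous_on_cos_poly[of UNIV c n] pi_gt_zero order_refl, of k] fz
    unfolding few_zeros_def by blast
  obtain p :: "int \<Rightarrow> real" where p: "\<And>t. complex_of_real (\<Prod>y\<leftarrow>ys. 2 * cos y - 2 * cos t)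
      = trig {- int k..int k} (\<lambda>i. of_real (p i)) t"
    "\<And>i. int k < \<bar>i\<bar> \<Longrightarrow> p i = 0" "\<bar>p (- int k)\<bar> = 1" "\<And>i. \<bar>p i\<bar> \<le> 4 ^ k"
    using cos_prod_trig[of ys] unfolding ys(1) by blast
  define q where "q i = \<sigma> * p i" for i
  define d where "d m = (\<Sum>i\<in>{- int k..int k}. q i * ?b (m - i))" for m
  define F where "F t = \<sigma> * ?T t * (\<Prod>y\<leftarrow>ys. 2 * cos y - 2 * cos t)" for t
  have abs\<sigma>: "\<bar>\<sigma> * x\<bar> = \<bar>x\<bar>" for x using ys(2) by auto
  have contF: "continuous_on S F" for S
  proof -
    have "continuous_on S (\<lambda>t. \<Prod>y\<leftarrow>ys. 2 * cos y - 2 * cos t)"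
      by (induction ys) (auto intro!: continuous_intros)
    then show ?thesis unfolding F_def[abs_def] by (intro continuous_intros)
  qed
  have F: "trig ?K (\<lambda>m. of_real (d m)) t = complex_of_real (F t)" for t
  proof -
    have "trig {- int k..int k} (\<lambda>i. of_real (q i)) t = of_real \<sigma> * trig {- int k..int k} (\<lambda>i. of_real (p i)) t"
      by (simp add: trig_def q_def sum_distrib_left mult.assoc)
    then have "complex_of_real (F t) = trig {- int k..int k} (\<lambda>i. of_real (q i)) t
        * trig {- int n..int n} (\<lambda>j. of_real (?b j)) t"
      by (simp add: F_def p(1)[symmetric] cos_poly_trig[symmetric])
    also have "\<dots> = trig ?K (\<lambda>m. \<Sum>i\<in>{- int k..int k}. of_real (q i) * of_real (?b (m - i))) t"
      by (rule trig_mult) (auto simp: sym_coeff_def)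
    finally show ?thesis by (simp add: d_def)
  qed
  \<comment> \<open>The sign is known on the open interval only; continuity adds the endpoints and
    evenness the negative half.\<close>
  have "0 \<le> F t" if "t \<in> {-pi..pi}" for t
  proof -
    have "0 \<le> F u" if "u \<in> closure {0<..<pi}" for u
      by (rule continuous_ge_on_closure[OF contF that]) (use ys(3) in \<open>auto simp: F_def\<close>)
    then have pos: "0 \<le> F u" if "u \<in> {0..pi}" for u using that by (simp add: closure_greaterThanLessThan)
    have "F t = F \<bar>t\<bar>" by (cases "0 \<le> t") (auto simp: F_def)
    then show ?thesis using pos[of "\<bar>t\<bar>"] that by auto
  qed
  then have "integral {-pi..pi} (\<lambda>t. norm (trig ?K (\<lambda>m. of_real (d m)) t)) = integral {-pi..pi} F"
    by (intro integral_cong) (simp only: F norm_of_real abs_of_nonneg)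
  also have "\<dots> = 2 * pi * d 0"
  proof -
    have "d j = 0" if "j \<notin> ?K" for j
      unfolding d_def by (rule sum.neutral) (use that in \<open>auto simp: sym_coeff_def\<close>)
    then have "pairing (trig ?K (\<lambda>m. of_real (d m))) (\<lambda>t. cis (- of_int 0 * t)) = complex_of_real (d 0)"
      by (intro pairing_trig_cis) auto
    then have "integral {-pi..pi} (\<lambda>t. complex_of_real (F t)) = complex_of_real (2 * pi * d 0)"
      unfolding pairing_def ext[of "trig ?K (\<lambda>m. of_real (d m))" "\<lambda>t. of_real (F t)", OF F]
      by (simp add: field_simps)
    moreover have "(F has_integral integral {-pi..pi} F) {-pi..pi}"
      by (intro integrable_integral integrable_continuous_interval contF)
    then have "((\<lambda>t. complex_of_real (F t)) has_integral complex_of_real (integral {-pi..pi} F)) {-pi..pi}"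
      by (rule has_integral_of_real)
    ultimately show ?thesis by (metis integral_unique of_real_eq_iff)
  qed
  also have "d 0 \<le> (2 * real k + 1) * 4 ^ k * B"
  proof -
    have "d 0 \<le> (\<Sum>i\<in>{- int k..int k}. 4 ^ k * B)"
      unfolding d_def
    proof (rule sum_mono)
      fix i
      have "\<bar>q i * ?b (0 - i)\<bar> \<le> 4 ^ k * B"
        unfolding abs_mult using p(4)[of i] B[of "0 - i"] by (intro mult_mono) (auto simp: q_def abs\<sigma>)
      then show "q i * ?b (0 - i) \<le> 4 ^ k * B" by linarith
    qed
    also have "\<dots> = (2 * real k + 1) * 4 ^ k * B" by simp
    finally show ?thesis .
  qed
  finally have "integral {-pi..pi} (\<lambda>t. norm (trig ?K (\<lambda>m. of_real (d m)) t)) \<le> 2 * pi * ((2 * real k + 1) * 4 ^ k * B)"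
    by simp
  then show ?thesis
    using p by (intro exI[of _ q]) (simp add: d_def q_def abs\<sigma>)
qed

section \<open>Coefficients with few breaks of periodicity\<close>

lemma finite_break_points: "finite {u. sym_coeff c n (u + int P) \<noteq> sym_coeff c n u}"
proof (rule finite_subset)
  show "{u. sym_coeff c n (u + int P) \<noteq> sym_coeff c n u} \<subseteq> {- int (n + P)..int (n + P)}"
  proof
    fix u assume "u \<in> {u. sym_coeff c n (u + int P) \<noteq> sym_coeff c n u}"
    then show "u \<in> {- int (n + P)..int (n + P)}"
      by (rule contrapos_pp) (auto simp: sym_coeff_def)
  qed
qed simp

text \<open>Multiplication by the exponential minus 1 takes differences of coefficients at distance
  \<open>P\<close>, which vanish except at the break points.\<close>

lemma shifted_difference:
  fixes c n P
  defines "b \<equiv> sym_coeff c n"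
  defines "J \<equiv> {u. b (u + int P) \<noteq> b u}"
  shows "(cis (- real P * t) - 1) * complex_of_real (cos_poly c n t)
    = trig J (\<lambda>u. of_real (b (u + int P) - b u)) t"
proof (cases "P = 0")
  case True
  then show ?thesis by (simp add: trig_def)
next
  case False
  define e :: "int \<Rightarrow> complex" where "e i = (if i = 0 then -1 else 1)" for i
  let ?K = "{- int (n + P)..int (n + P)}"
  have "cis (- real P * t) - 1 = trig {- int P, 0} e t" using False by (simp add: trig_def e_def)
  then have "(cis (- real P * t) - 1) * complex_of_real (cos_poly c n t)
      = trig {- int P, 0} e t * trig {- int n..int n} (\<lambda>j. of_real (b j)) t"
    by (simp add: cos_poly_trig b_def)
  also have "\<dots> = trig ?K (\<lambda>m. \<Sum>i\<in>{- int P, 0}. e i * of_real (b (m - i))) t"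
    by (rule trig_mult) (auto simp: b_def sym_coeff_def)
  also have "(\<lambda>m. \<Sum>i\<in>{- int P, 0}. e i * of_real (b (m - i))) = (\<lambda>u. complex_of_real (b (u + int P) - b u))"
    using False by (auto simp: e_def)
  also have "trig ?K \<dots> t = trig J (\<lambda>u. of_real (b (u + int P) - b u)) t"
    unfolding trig_def
  proof (rule sum.mono_neutral_right)
    show "J \<subseteq> ?K"
    proof
      fix u assume "u \<in> J"
      then show "u \<in> ?K" by (rule contrapos_pp) (auto simp: J_def b_def sym_coeff_def)
    qed
  qed (auto simp: J_def)
  finally show ?thesis .
qed

lemma shifted_difference_bound:
  assumes "\<And>j. \<bar>sym_coeff c n j\<bar> \<le> B"
    and "card {u. sym_coeff c n (u + int P) \<noteq> sym_coeff c n u} \<le> K"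
  shows "norm ((cis (- real P * t) - 1) * complex_of_real (cos_poly c n t)) \<le> 2 * real K * B"
proof -
  let ?b = "sym_coeff c n"
  let ?J = "{u. ?b (u + int P) \<noteq> ?b u}"
  have "0 \<le> B" using assms(1)[of 0] by linarith
  have "norm ((cis (- real P * t) - 1) * complex_of_real (cos_poly c n t)) \<le> (\<Sum>u\<in>?J. 2 * B)"
    unfolding shifted_difference trig_def
  proof (rule order_trans[OF norm_sum], rule sum_mono)
    fix u
    have "norm (complex_of_real (?b (u + int P) - ?b u) * cis (of_int u * t)) = \<bar>?b (u + int P) - ?b u\<bar>"
      by (simp only: norm_mult norm_of_real norm_cis mult_1_right)
    then show "norm (complex_of_real (?b (u + int P) - ?b u) * cis (of_int u * t)) \<le> 2 * B"
      using assms(1)[of u] assms(1)[of "u + int P"] by linarith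
  qed
  also have "\<dots> = card ?J * (2 * B)" by simp
  also have "\<dots> \<le> K * (2 * B)" using assms(2) \<open>0 \<le> B\<close> by (intro mult_right_mono) auto
  finally show ?thesis by simp
qed

text \<open>Multiplying \<open>shifted_difference\<close> by \<open>cis (P * t / 2)\<close> turns
  its factor into \<open>- 2 * \<i> * sin (P * t / 2)\<close>. As the cosine polynomial is real,
  comparing imaginary parts leaves one sine per break point.\<close>

lemma cos_poly_sine_quotient:
  fixes c n P
  defines "b \<equiv> sym_coeff c n"
  defines "J \<equiv> {u. b (u + int P) \<noteq> b u}"
  shows "- 2 * sin (real P * t / 2) * cos_poly c n t
    = (\<Sum>u\<in>J. (b (u + int P) - b u) * sin ((of_int u + real P / 2) * t))"
proof -
  have "cis x * (cis (- (2 * x)) - 1) = - 2 * \<i> * of_real (sin x)" for x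
    by (simp add: right_diff_distrib cis_mult complex_eq_iff)
  from this[of "real P * t / 2"]
  have "cis (real P * t / 2) * (cis (- real P * t) - 1) = - 2 * \<i> * of_real (sin (real P * t / 2))"
    by simp
  then have "- 2 * \<i> * of_real (sin (real P * t / 2)) * complex_of_real (cos_poly c n t)
     = cis (real P * t / 2) * trig J (\<lambda>u. of_real (b (u + int P) - b u)) t"
    unfolding J_def b_def shifted_difference[symmetric] by (simp only: mult.assoc[symmetric])
  also have "\<dots> = (\<Sum>u\<in>J. of_real (b (u + int P) - b u) * cis ((of_int u + real P / 2) * t))"
    unfolding trig_def sum_distrib_left
    by (intro sum.cong refl) (simp add: mult.left_commute cis_mult algebra_simps)
  finally have "Im (- 2 * \<i> * of_real (sin (real P * t / 2)) * complex_of_real (cos_poly c n t))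
     = Im (\<Sum>u\<in>J. of_real (b (u + int P) - b u) * cis ((of_int u + real P / 2) * t))" by simp
  moreover have "Im (complex_of_real x * cis y) = x * sin y" for x y by simp
  ultimately show ?thesis by (simp only: Im_sum) simp
qed

text \<open>Up to \<open>pi / (2 * P)\<close> the sine in the denominator vanishes only at 0. Each
  of at most \<open>K\<close> break points has weight at most \<open>B\<close>, and its sine
  quotient has integral at most 20.\<close>

lemma integral_cos_poly_bound:
  assumes "\<And>j. \<bar>sym_coeff c n j\<bar> \<le> B" "1 \<le> P"
    and K: "card {u. sym_coeff c n (u + int P) \<noteq> sym_coeff c n u} \<le> K"
    and xy: "0 \<le> x" "x \<le> y" "y \<le> pi / (2 * real P)"
  shows "\<bar>integral {x..y} (cos_poly c n)\<bar> \<le> 20 * real K * B"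
proof -
  let ?b = "sym_coeff c n" and ?T = "cos_poly c n"
  define J where "J = {u. ?b (u + int P) \<noteq> ?b u}"
  have "finite J" unfolding J_def by (rule finite_break_points)
  have "0 \<le> B" using assms(1)[of 0] by linarith
  have pos: "\<bar>integral {x..y} ?T\<bar> \<le> 20 * real K * B" if xy: "0 < x" "x \<le> y" "y \<le> pi / (2 * real P)" for x y
  proof -
    have sin_pos: "0 < sin (real P * t / 2)" if "t \<in> {x..y}" for t
    proof (rule sin_gt_zero)
      have "t \<le> pi / (2 * real P)" using that xy by auto
      then have "2 * (real P * t) \<le> pi" using assms by (simp add: field_simps)
      then show "real P * t / 2 < pi" using pi_gt_zero by linarith
      show "0 < real P * t / 2" using that xy assms by simp
    qed
    let ?g = "\<lambda>u t. sin ((of_int u + real P / 2) * t) / sin (real P * t / 2)"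
    have "integral {x..y} ?T = integral {x..y} (\<lambda>t. \<Sum>u\<in>J. - (?b (u + int P) - ?b u) / 2 * ?g u t)"
    proof (rule integral_cong)
      fix t assume t: "t \<in> {x..y}"
      have "?T t = (\<Sum>u\<in>J. (?b (u + int P) - ?b u) * sin ((of_int u + real P / 2) * t)) / (- 2 * sin (real P * t / 2))"
        using sin_pos[OF t] cos_poly_sine_quotient[of P t c n] by (simp add: J_def field_simps)
      also have "\<dots> = (\<Sum>u\<in>J. - (?b (u + int P) - ?b u) / 2 * ?g u t)"
        using sin_pos[OF t] unfolding sum_divide_distrib by (intro sum.cong refl) (simp add: field_simps)
      finally show "?T t = (\<Sum>u\<in>J. - (?b (u + int P) - ?b u) / 2 * ?g u t)" .
    qed
    also have "\<dots> = (\<Sum>u\<in>J. integral {x..y} (\<lambda>t. - (?b (u + int P) - ?b u) / 2 * ?g u t))"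
    proof (rule integral_sum[OF \<open>finite J\<close>])
      fix u
      show "(\<lambda>t. - (?b (u + int P) - ?b u) / 2 * ?g u t) integrable_on {x..y}"
        using sin_pos by (intro integrable_continuous_interval continuous_intros) (auto simp: less_imp_neq[symmetric])
    qed
    also have "\<dots> = (\<Sum>u\<in>J. - (?b (u + int P) - ?b u) / 2 * integral {x..y} (?g u))"
      by (simp only: integral_mult_right)
    finally have eq: "integral {x..y} ?T = (\<Sum>u\<in>J. - (?b (u + int P) - ?b u) / 2 * integral {x..y} (?g u))" .
    have "\<bar>integral {x..y} ?T\<bar> \<le> (\<Sum>u\<in>J. \<bar>- (?b (u + int P) - ?b u) / 2 * integral {x..y} (?g u)\<bar>)"
      unfolding eq by (rule sum_abs)
    also have "\<dots> \<le> (\<Sum>u\<in>J. B * 20)"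
    proof (rule sum_mono)
      fix u
      have "\<bar>- (?b (u + int P) - ?b u) / 2\<bar> \<le> B" using assms(1)[of u] assms(1)[of "u + int P"] by simp
      moreover have "\<bar>integral {x..y} (?g u)\<bar> \<le> 20"
        using integral_sin_quotient_bound[of "real P" x y] xy assms by simp
      ultimately show "\<bar>- (?b (u + int P) - ?b u) / 2 * integral {x..y} (?g u)\<bar> \<le> B * 20"
        unfolding abs_mult using \<open>0 \<le> B\<close> by (intro mult_mono) auto
    qed
    also have "\<dots> = card J * (B * 20)" by simp
    also have "\<dots> \<le> K * (B * 20)" using K \<open>0 \<le> B\<close> unfolding J_def by (intro mult_right_mono) auto
    finally show ?thesis by simp
  qed
  show ?thesis
  proof (cases "x = 0 \<and> 0 < y")
    case False
    then show ?thesis using pos[of x y] xy \<open>0 \<le> B\<close> by (cases "x = y") auto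
  next
    case True
    \<comment> \<open>At the left end 0 the quotient has a pole term by term; the bound is carried
      there by continuity of the integral in its lower limit.\<close>
    have "continuous_on {0..y} (\<lambda>x. integral {x..y} ?T)"
      by (intro indefinite_integral_continuous_1' integrable_continuous_interval continuous_intros)
    then have "continuous_on (closure {0<..y}) (\<lambda>x. \<bar>integral {x..y} ?T\<bar>)"
      using True by (simp add: continuous_intros)
    then have "\<bar>integral {0..y} ?T\<bar> \<le> 20 * real K * B"
      by (rule continuous_le_on_closure) (use pos xy True in auto)
    then show ?thesis using True by simp
  qed
qed

section \<open>Windowed sums of coefficients\<close>

lemma norm_geometric_window_le:
  "norm (trig {0..<int P} (\<lambda>_. 1) t) \<le> P"
proof -
  have "norm (trig {0..<int P} (\<lambda>_. 1) t) \<le> (\<Sum>j\<in>{0..<int P}. 1)"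
    unfolding trig_def by (rule order_trans[OF norm_sum]) (simp add: norm_mult)
  then show ?thesis by simp
qed

text \<open>The window cancels the zeros of \<open>cis (P * t) - 1\<close> except those at multiples
  of \<open>2 * pi\<close>, so only the neighbourhood of 0 needs separate treatment.\<close>

lemma geometric_window: "(cis t - 1) * trig {0..<int P} (\<lambda>_. 1) t = cis (real P * t) - 1"
proof (induction P)
  case 0
  then show ?case by (simp add: trig_def)
next
  case (Suc P)
  have "{0..<int (Suc P)} = insert (int P) {0..<int P}" by auto
  then have "trig {0..<int (Suc P)} (\<lambda>_. 1) t = cis (real P * t) + trig {0..<int P} (\<lambda>_. 1) t"
    by (simp add: trig_def)
  moreover have "cis (real (Suc P) * t) = cis t * cis (real P * t)"
    by (simp add: cis_mult algebra_simps)
  ultimately show ?case using Suc.IH by (simp only:) (simp add: algebra_simps)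
qed

lemma norm_cis_minus_one: "(norm (cis t - 1))^2 = 2 - 2 * cos t"
proof -
  have "(norm (cis t - 1))^2 = (cos t)^2 + (sin t)^2 - 2 * cos t + 1"
    by (simp only: cmod_power2) (simp add: power2_eq_square algebra_simps)
  then show ?thesis by (simp only: sin_cos_squared_add2)
qed

text \<open>Away from 0, \<open>norm (cis t - 1)\<close> is at least
  \<open>sqrt (2 - 2 * cos \<rho>)\<close> and the shifted difference is bounded, so the product is
  bounded pointwise. Within \<open>\<rho>\<close> of 0 the window is at most \<open>P\<close>, and
  few zeros turn the bounds on integrals into a bound on the integral of the absolute value.\<close>

lemma windowed_integral_bound:
  assumes fz: "few_zeros k (cos_poly c n)" and B: "\<And>j. \<bar>sym_coeff c n j\<bar> \<le> B" and "1 \<le> P"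
    and K: "card {u. sym_coeff c n (u + int P) \<noteq> sym_coeff c n u} \<le> K"
  defines "\<rho> \<equiv> pi / (2 * real P)"
  shows "integral {-pi..pi} (\<lambda>t. norm (trig {0..<int P} (\<lambda>_. 1) t * complex_of_real (cos_poly c n t)))
    \<le> 2 * pi * (2 * real K * B / sqrt (2 - 2 * cos \<rho>)) + 2 * (real P * ((real k + 1) * (20 * real K * B)))"
proof -
  let ?T = "cos_poly c n" and ?W = "trig {0..<int P} (\<lambda>_. 1)"
  let ?f = "\<lambda>t. norm (?W t * complex_of_real (?T t))"
  have "0 \<le> B" using B[of 0] by linarith
  define C0 where "C0 = 2 * real K * B / sqrt (2 - 2 * cos \<rho>)"
  have \<rho>: "0 < \<rho>" "\<rho> \<le> pi / 2" using \<open>1 \<le> P\<close> pi_gt_zero by (auto simp: \<rho>_def field_simps)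
  then have "cos \<rho> < cos 0" by (intro cos_monotone_0_pi) auto
  then have pos: "0 < 2 - 2 * cos \<rho>" by simp
  have C0: "0 \<le> C0" using pos \<open>0 \<le> B\<close> by (simp add: C0_def)
  have far: "?f t \<le> C0" if "\<rho> \<le> \<bar>t\<bar>" "\<bar>t\<bar> \<le> pi" for t
  proof -
    have "cos \<bar>t\<bar> \<le> cos \<rho>" using that \<rho> by (intro cos_monotone_0_pi_le) auto
    then have "sqrt (2 - 2 * cos \<rho>) \<le> sqrt ((norm (cis t - 1))^2)"
      unfolding norm_cis_minus_one by simp
    then have lower: "sqrt (2 - 2 * cos \<rho>) \<le> norm (cis t - 1)" by simp
    have "cis (real P * t) - 1 = - (cis (real P * t) * (cis (- real P * t) - 1))"
      by (simp add: right_diff_distrib cis_mult)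
    then have "norm ((cis (real P * t) - 1) * complex_of_real (?T t))
        = norm ((cis (- real P * t) - 1) * complex_of_real (?T t))"
      by (simp only: norm_mult norm_minus_cancel norm_cis mult_1_left)
    also have "\<dots> \<le> 2 * real K * B" by (rule shifted_difference_bound[OF B K])
    finally have "norm (cis t - 1) * ?f t \<le> 2 * real K * B"
      by (simp only: geometric_window[symmetric] norm_mult mult.assoc)
    moreover have "sqrt (2 - 2 * cos \<rho>) * ?f t \<le> norm (cis t - 1) * ?f t"
      using lower by (intro mult_right_mono) auto
    ultimately show ?thesis unfolding C0_def using pos by (simp add: field_simps)
  qed
  have near: "?f t \<le> real P * \<bar>?T t\<bar>" for t
    unfolding norm_mult norm_of_real by (intro mult_right_mono norm_geometric_window_le) auto
  have integrable: "?f integrable_on {a..b}" "(\<lambda>t. real P * \<bar>?T t\<bar>) integrable_on {a..b}" for a b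
    by (intro integrable_continuous_interval continuous_intros)+
  have far_int: "integral {a..b} ?f \<le> C0 * (b - a)" if "a \<le> b" "\<And>t. t \<in> {a..b} \<Longrightarrow> \<rho> \<le> \<bar>t\<bar> \<and> \<bar>t\<bar> \<le> pi" for a b
  proof -
    have "integral {a..b} ?f \<le> integral {a..b} (\<lambda>_. C0)"
      using far that(2) by (intro integral_le integrable) auto
    then show ?thesis using that(1) by (simp add: mult.commute)
  qed
  have T0: "integral {0..\<rho>} (\<lambda>t. \<bar>?T t\<bar>) \<le> (real k + 1) * (20 * real K * B)"
  proof (rule integral_abs_few_zeros)
    have sub: "{t\<in>{0<..<\<rho>}. ?T t = 0} \<subseteq> {t\<in>{0<..<pi}. ?T t = 0}" using \<rho> by auto
    then show "finite {t\<in>{0<..<\<rho>}. ?T t = 0}" "card {t\<in>{0<..<\<rho>}. ?T t = 0} \<le> k"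
      using fz finite_subset[OF sub] card_mono[OF _ sub] unfolding few_zeros_def by auto
    show "\<bar>integral {x..y} ?T\<bar> \<le> 20 * real K * B" if "0 \<le> x" "x \<le> y" "y \<le> \<rho>" for x y
      using integral_cos_poly_bound[OF B \<open>1 \<le> P\<close> K] that unfolding \<rho>_def by blast
  qed (use \<rho> in \<open>auto intro: continuous_on_cos_poly\<close>)
  have n1: "integral {0..\<rho>} ?f \<le> real P * ((real k + 1) * (20 * real K * B))"
  proof -
    have "integral {0..\<rho>} ?f \<le> integral {0..\<rho>} (\<lambda>t. real P * \<bar>?T t\<bar>)"
      using near by (intro integral_le integrable) auto
    also have "\<dots> = real P * integral {0..\<rho>} (\<lambda>t. \<bar>?T t\<bar>)" by simp
    also have "\<dots> \<le> real P * ((real k + 1) * (20 * real K * B))" using T0 by (intro mult_left_mono) auto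
    finally show ?thesis .
  qed
  have n2: "integral {-\<rho>..0} ?f \<le> real P * ((real k + 1) * (20 * real K * B))"
  proof -
    have "integral {-\<rho>..0} ?f \<le> integral {-\<rho>..0} (\<lambda>t. real P * \<bar>?T t\<bar>)"
      using near by (intro integral_le integrable) auto
    also have "\<dots> = real P * integral {-\<rho>..0} (\<lambda>t. \<bar>?T t\<bar>)" by simp
    also have "integral {-\<rho>..0} (\<lambda>t. \<bar>?T t\<bar>) = integral {0..\<rho>} (\<lambda>t. \<bar>?T t\<bar>)"
      using Henstock_Kurzweil_Integration.integral_reflect_real[of \<rho> 0 "\<lambda>t. \<bar>?T t\<bar>"] by simp
    also have "real P * \<dots> \<le> real P * ((real k + 1) * (20 * real K * B))" using T0 by (intro mult_left_mono) auto
    finally show ?thesis .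
  qed
  have "integral {-pi..pi} ?f = integral {-pi..-\<rho>} ?f + (integral {-\<rho>..0} ?f + (integral {0..\<rho>} ?f + integral {\<rho>..pi} ?f))"
    using \<rho> by (simp add: Henstock_Kurzweil_Integration.integral_combine[OF _ _ integrable(1)])
  also have "\<dots> \<le> C0 * (- \<rho> - (-pi)) + (real P * ((real k + 1) * (20 * real K * B)) + (real P * ((real k + 1) * (20 * real K * B)) + C0 * (pi - \<rho>)))"
    using \<rho> by (intro add_mono n1 n2 far_int) auto
  also have "\<dots> \<le> 2 * pi * C0 + 2 * (real P * ((real k + 1) * (20 * real K * B)))"
    using C0 \<rho> by (simp add: algebra_simps)
  finally show ?thesis unfolding C0_def .
qed

text \<open>The window sums \<open>F\<close> of nonnegative coefficients dominate every coefficient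
  in the window. Hence a nonzero \<open>F m\<close> is at least \<open>\<delta> / 2\<close>, the
  half coming from \<open>sym_coeff\<close>, and the support of \<open>F\<close> contains that of
  \<open>c\<close>; the weak Littlewood theorem bounds it.\<close>

lemma NC_bounded_of_few_breaks:
  fixes \<delta> B :: real and k P K :: nat
  assumes "0 < \<delta>" "1 \<le> P"
  shows "\<exists>N. \<forall>c n. (\<forall>j\<le>n. c j = 0 \<or> \<delta> \<le> c j) \<longrightarrow> (\<forall>j. \<bar>sym_coeff c n j\<bar> \<le> B) \<longrightarrow> few_zeros k (cos_poly c n) \<longrightarrow>
    card {u. sym_coeff c n (u + int P) \<noteq> sym_coeff c n u} \<le> K \<longrightarrow> NC c n < N"
proof -
  define C where "C = (2 * pi * (2 * real K * B / sqrt (2 - 2 * cos (pi / (2 * real P))))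
      + 2 * (real P * ((real k + 1) * (20 * real K * B)))) / (2 * pi)"
  obtain \<epsilon> N where \<epsilon>: "0 < \<epsilon>" and N: "\<And>\<epsilon>' J d E. 0 < \<epsilon>' \<Longrightarrow> \<epsilon>' \<le> \<epsilon> \<Longrightarrow> admissible C (\<delta> / 2) \<epsilon>' J d E \<Longrightarrow> card E < N"
    using weak_littlewood[OF half_gt_zero[OF assms(1)], of C] by blast
  have "NC c n < N" if c: "\<And>j. j \<le> n \<Longrightarrow> c j = 0 \<or> \<delta> \<le> c j" and B: "\<And>j. \<bar>sym_coeff c n j\<bar> \<le> B"
    and fz: "few_zeros k (cos_poly c n)" and K: "card {u. sym_coeff c n (u + int P) \<noteq> sym_coeff c n u} \<le> K" for c n
  proof -
    let ?b = "sym_coeff c n" and ?K = "{- int n..int (n + P)}"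
    define F where "F m = (\<Sum>i\<in>{0..<int P}. ?b (m - i))" for m
    define E where "E = {m. F m \<noteq> 0}"
    have b: "?b j = 0 \<or> \<delta> / 2 \<le> ?b j" for j
      using c[of 0] c[of "nat \<bar>j\<bar>"] \<open>0 < \<delta>\<close> by (auto simp: sym_coeff_def)
    then have b0: "0 \<le> ?b j" for j using \<open>0 < \<delta>\<close> by (metis half_gt_zero less_eq_real_def order_trans)
    have ge: "?b (m - i) \<le> F m" if "i \<in> {0..<int P}" for m i
      unfolding F_def using that b0 by (intro member_le_sum) auto
    have F0: "F m = 0" if "m \<notin> ?K" for m
      unfolding F_def by (rule sum.neutral) (use that in \<open>auto simp: sym_coeff_def\<close>)
    have trigF: "trig ?K (\<lambda>m. of_real (F m)) t = trig {0..<int P} (\<lambda>_. 1) t * complex_of_real (cos_poly c n t)" for t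
    proof -
      have "trig {0..<int P} (\<lambda>_. 1) t * trig {- int n..int n} (\<lambda>j. of_real (?b j)) t
          = trig ?K (\<lambda>m. \<Sum>i\<in>{0..<int P}. 1 * of_real (?b (m - i))) t"
        by (rule trig_mult) (auto simp: sym_coeff_def)
      then show ?thesis by (simp add: cos_poly_trig F_def)
    qed
    have "admissible C (\<delta> / 2) \<epsilon> ?K (\<lambda>m. complex_of_real (F m)) E"
      unfolding admissible_def
    proof (intro conjI ballI allI impI)
      fix m assume "m \<in> E"
      then obtain i where i: "i \<in> {0..<int P}" "?b (m - i) \<noteq> 0"
        unfolding E_def F_def by (metis (mono_tags, lifting) mem_Collect_eq sum.neutral)
      then have "\<delta> / 2 \<le> F m" using b[of "m - i"] ge[OF i(1), of m] by linarith
      then show "\<delta> / 2 \<le> norm (complex_of_real (F m))" by simp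
    next
      have "integral {-pi..pi} (\<lambda>t. norm (trig ?K (\<lambda>m. complex_of_real (F m)) t)) \<le>
        2 * pi * (2 * real K * B / sqrt (2 - 2 * cos (pi / (2 * real P)))) + 2 * (real P * ((real k + 1) * (20 * real K * B)))"
        unfolding trigF by (rule windowed_integral_bound[OF fz B \<open>1 \<le> P\<close> K])
      then show "integral {-pi..pi} (\<lambda>t. norm (trig ?K (\<lambda>m. complex_of_real (F m)) t)) \<le> 2 * pi * C"
        by (simp add: C_def)
    qed (use \<epsilon> F0 in \<open>auto simp: E_def\<close>)
    then have "card E < N" "finite E"
      using N[OF \<epsilon> order_refl] admissible_finite[of C "\<delta> / 2"] \<open>0 < \<delta>\<close> by auto
    have "int ` {j \<in> {0..n}. c j \<noteq> 0} \<subseteq> E"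
    proof
      fix m assume "m \<in> int ` {j \<in> {0..n}. c j \<noteq> 0}"
      then obtain j where j: "m = int j" "j \<le> n" "c j \<noteq> 0" by auto
      then have "?b m \<noteq> 0" by (auto simp: sym_coeff_def)
      then have "0 < ?b m" using b0[of m] by linarith
      moreover have "?b m \<le> F m" using ge[of 0 m] \<open>1 \<le> P\<close> by simp
      ultimately show "m \<in> E" by (simp add: E_def)
    qed
    then have "card (int ` {j \<in> {0..n}. c j \<noteq> 0}) \<le> card E" by (rule card_mono[OF \<open>finite E\<close>])
    then show ?thesis using \<open>card E < N\<close> by (simp add: NC_def card_image)
  qed
  then show ?thesis by blast
qed

section \<open>Compactness argument along a sequence of counterexamples\<close>

lemma NC_bounded_of_few_zeros:
  fixes S :: "real set"
  assumes "finite S" "S \<subseteq> {0..}"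
  shows "\<exists>N. \<forall>c n. (\<forall>j\<le>n. c j \<in> S) \<longrightarrow> few_zeros k (cos_poly c n) \<longrightarrow> NC c n < N"
proof (rule ccontr)
  assume "\<not> ?thesis"
  then have "\<forall>N. \<exists>c n. (\<forall>j\<le>n. c j \<in> S) \<and> few_zeros k (cos_poly c n) \<and> N \<le> NC c n"
    by (meson not_less)
  then obtain c n where c: "\<And>N j. j \<le> n N \<Longrightarrow> c N j \<in> S" and fz: "\<And>N. few_zeros k (cos_poly (c N) (n N))"
    and large: "\<And>N. N \<le> NC (c N) (n N)"
    by metis
  define V where "V = insert 0 (S \<union> (\<lambda>x. x / 2) ` S)"
  define B where "B = Max (insert 1 S)"
  define \<delta> where "\<delta> = Min (insert 1 (S - {0}))"
  have "finite V" using assms by (simp add: V_def)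
  have B: "1 \<le> B" "\<And>x. x \<in> S \<Longrightarrow> x \<le> B" using assms by (auto simp: B_def)
  have "0 < \<delta>"
  proof -
    have "\<delta> \<in> insert 1 (S - {0})" unfolding \<delta>_def using assms by (intro Min_in) auto
    then show ?thesis using assms(2) by (force simp: less_le)
  qed
  have \<delta>: "x = 0 \<or> \<delta> \<le> x" if "x \<in> S" for x
    unfolding \<delta>_def using that assms by (cases "x = 0") (auto intro!: Min_le)
  define b where "b N = sym_coeff (c N) (n N)" for N
  have bV: "b N j \<in> V" for N j
    using c[of 0 N] c[of "nat \<bar>j\<bar>" N] by (auto simp: b_def V_def sym_coeff_def)
  have bB: "\<bar>b N j\<bar> \<le> B" for N j
    using bV[of N j] B assms(2) by (force simp: V_def)
  define C where "C = (2 * real k + 1) * 4 ^ k * B"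
  define d where "d N q m = (\<Sum>i\<in>{- int k..int k}. q i * b N (m - i))" for N and q :: "int \<Rightarrow> real" and m
  have "\<forall>N. \<exists>q :: int \<Rightarrow> real. \<bar>q (- int k)\<bar> = 1 \<and> (\<forall>i. \<bar>q i\<bar> \<le> 4 ^ k) \<and>
    integral {-pi..pi} (\<lambda>t. norm (trig {- int (n N + k)..int (n N + k)} (\<lambda>m. of_real (d N q m)) t)) \<le> 2 * pi * C"
    using few_zeros_product[OF fz] bB unfolding b_def C_def d_def by blast
  then obtain q :: "nat \<Rightarrow> int \<Rightarrow> real" where q: "\<And>N. \<bar>q N (- int k)\<bar> = 1" "\<And>N i. \<bar>q N i\<bar> \<le> 4 ^ k"
    "\<And>N. integral {-pi..pi} (\<lambda>t. norm (trig {- int (n N + k)..int (n N + k)} (\<lambda>m. of_real (d N (q N) m)) t)) \<le> 2 * pi * C"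
    by metis
  \<comment> \<open>Diagonal extraction: the coefficients of the correcting polynomials are bounded
    by \<open>4 ^ k\<close> uniformly in \<open>N\<close>, so a subsequence converges at every
    index.\<close>
  obtain r :: "nat \<Rightarrow> nat" where r: "strict_mono r" "\<And>i. \<exists>l. (\<lambda>N. q (r N) i) \<longlonglongrightarrow> l"
    using function_convergent_subsequence[of "UNIV :: int set" q "4 ^ k"] q(2) by auto
  then obtain q' where q': "\<And>i. (\<lambda>N. q (r N) i) \<longlonglongrightarrow> q' i" by metis
  have "q' (- int k) \<noteq> 0"
  proof -
    have "(\<lambda>N. \<bar>q (r N) (- int k)\<bar>) \<longlonglongrightarrow> \<bar>q' (- int k)\<bar>" by (intro tendsto_intros q')
    then have "\<bar>q' (- int k)\<bar> = 1" by (simp add: q(1) LIMSEQ_const_iff)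
    then show ?thesis by auto
  qed
  \<comment> \<open>All values that the limit polynomial can produce from coefficients in
    \<open>V\<close>. This set is finite and does not depend on \<open>N\<close>, so its nonzero
    elements are bounded away from 0.\<close>
  define D where "D = (\<lambda>v. \<Sum>i\<in>{- int k..int k}. q' i * v i) ` (PiE {- int k..int k} (\<lambda>_. V))"
  have "finite D" unfolding D_def using \<open>finite V\<close> by (intro finite_imageI finite_PiE) auto
  have dD: "d N q' m \<in> D" for N m
  proof -
    have "d N q' m = (\<Sum>i\<in>{- int k..int k}. q' i * restrict (\<lambda>i. b N (m - i)) {- int k..int k} i)"
      unfolding d_def by (intro sum.cong) auto
    then show ?thesis unfolding D_def using bV by (intro image_eqI[of _ _ "restrict (\<lambda>i. b N (m - i)) {- int k..int k}"]) auto
  qed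
  define \<delta>' where "\<delta>' = Min (insert 1 (abs ` (D - {0})))"
  have "0 < \<delta>'"
  proof -
    have "\<delta>' \<in> insert 1 (abs ` (D - {0}))" unfolding \<delta>'_def using \<open>finite D\<close> by (intro Min_in) auto
    then show ?thesis by auto
  qed
  have \<delta>': "\<delta>' \<le> \<bar>x\<bar>" if "x \<in> D" "x \<noteq> 0" for x
    using that \<open>finite D\<close> by (auto simp: \<delta>'_def)
  obtain \<epsilon> N1 where \<epsilon>: "0 < \<epsilon>" and N1: "\<And>\<epsilon>' J d E. 0 < \<epsilon>' \<Longrightarrow> \<epsilon>' \<le> \<epsilon> \<Longrightarrow> admissible C (\<delta>' / 2) \<epsilon>' J d E \<Longrightarrow> card E < N1"
    using weak_littlewood[OF half_gt_zero[OF \<open>0 < \<delta>'\<close>], of C] by blast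
  \<comment> \<open>An error of at most \<open>\<delta>' / 2\<close> leaves the nonzero values above
    \<open>\<delta>' / 2\<close>, and zero values become at most \<open>\<epsilon>'\<close>; this is
    the gap required by \<open>admissible\<close>.\<close>
  define \<epsilon>' where "\<epsilon>' = min \<epsilon> (\<delta>' / 2)"
  have \<epsilon>': "0 < \<epsilon>'" "\<epsilon>' \<le> \<epsilon>" "\<epsilon>' \<le> \<delta>' / 2" using \<epsilon> \<open>0 < \<delta>'\<close> by (auto simp: \<epsilon>'_def)
  obtain P w where Pw: "1 \<le> P" "0 \<le> w" and per: "\<forall>b E u. range b \<subseteq> V \<longrightarrow>
      (\<forall>j. j \<notin> E \<longrightarrow> (\<Sum>i\<in>{- int k..int k}. q' i * b (j - i)) = 0) \<longrightarrow>
      E \<inter> {u - w..u + w} = {} \<longrightarrow> b (u + int P) = b u"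
    using recurrence_periodic[where q = q' and k = k, OF \<open>finite V\<close> \<open>q' (- int k) \<noteq> 0\<close>]
    by (elim exE conjE)
  \<comment> \<open>The period, the radius and the number of exceptional positions depend on the
    limit \<open>q'\<close> only, so this bound is fixed before a member of the sequence is
    chosen.\<close>
  obtain N2 where N2: "\<forall>c n. (\<forall>j\<le>n. c j = 0 \<or> \<delta> \<le> c j) \<longrightarrow> (\<forall>j. \<bar>sym_coeff c n j\<bar> \<le> B) \<longrightarrow>
      few_zeros k (cos_poly c n) \<longrightarrow>
      card {u. sym_coeff c n (u + int P) \<noteq> sym_coeff c n u} \<le> N1 * nat (2 * w + 1) \<longrightarrow> NC c n < N2"
    using NC_bounded_of_few_breaks[OF \<open>0 < \<delta>\<close> Pw(1), of B k "N1 * nat (2 * w + 1)"] by (elim exE)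
  have "(\<lambda>N. (\<Sum>i\<in>{- int k..int k}. \<bar>q (r N) i - q' i\<bar>) * B) \<longlonglongrightarrow> (\<Sum>i\<in>{- int k..int k}. \<bar>q' i - q' i\<bar>) * B"
    by (intro tendsto_intros q')
  then have "\<forall>\<^sub>F N in sequentially. (\<Sum>i\<in>{- int k..int k}. \<bar>q (r N) i - q' i\<bar>) * B < \<epsilon>'"
    using \<epsilon>'(1) by (intro order_tendstoD(2)) auto
  then obtain N0 where N0: "\<And>N. N0 \<le> N \<Longrightarrow> (\<Sum>i\<in>{- int k..int k}. \<bar>q (r N) i - q' i\<bar>) * B < \<epsilon>'"
    unfolding eventually_sequentially by blast
  \<comment> \<open>Beyond \<open>N0\<close> the polynomials are close to their limit; beyond
    \<open>N2\<close> the assumed size of \<open>NC\<close> contradicts the bound, as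
    \<open>r N\<close> is at least \<open>N\<close>.\<close>
  define N where "N = max N0 N2"
  define R where "R = r N"
  have close: "\<bar>d R (q R) m - d R q' m\<bar> \<le> \<epsilon>'" for m
  proof -
    have "d R (q R) m - d R q' m = (\<Sum>i\<in>{- int k..int k}. (q R i - q' i) * b R (m - i))"
      by (simp add: d_def sum_subtractf algebra_simps)
    also have "\<bar>\<dots>\<bar> \<le> (\<Sum>i\<in>{- int k..int k}. \<bar>q R i - q' i\<bar> * B)"
      by (rule order_trans[OF sum_abs], rule sum_mono) (auto simp: abs_mult intro!: mult_left_mono bB)
    also have "\<dots> \<le> \<epsilon>'" using N0[of N] by (simp add: sum_distrib_right R_def N_def)
    finally show ?thesis .
  qed
  define E where "E = {m. d R q' m \<noteq> 0}"
  have "admissible C (\<delta>' / 2) \<epsilon>' {- int (n R + k)..int (n R + k)} (\<lambda>m. complex_of_real (d R (q R) m)) E"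
    unfolding admissible_def
  proof (intro conjI ballI allI impI)
    fix m assume "m \<in> E"
    then have "\<delta>' \<le> \<bar>d R q' m\<bar>" using dD \<delta>' by (simp add: E_def)
    then show "\<delta>' / 2 \<le> norm (complex_of_real (d R (q R) m))"
      using close[of m] \<epsilon>'(3) unfolding norm_of_real by linarith
  next
    fix m assume "m \<notin> E"
    then show "norm (complex_of_real (d R (q R) m)) \<le> \<epsilon>'"
      using close[of m] unfolding norm_of_real by (simp add: E_def)
  next
    fix m assume m: "m \<notin> {- int (n R + k)..int (n R + k)}"
    have "d R (q R) m = 0"
      unfolding d_def by (rule sum.neutral) (use m in \<open>auto simp: b_def sym_coeff_def\<close>)
    then show "complex_of_real (d R (q R) m) = 0" by simp
  qed (use q(3) in auto)
  then have E: "finite E" "card E \<le> N1"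
    using N1[OF \<epsilon>'(1,2)] admissible_finite[of C "\<delta>' / 2"] \<open>0 < \<delta>'\<close> by (auto simp: less_imp_le)
  have "b R (u + int P) = b R u" if "E \<inter> {u - w..u + w} = {}" for u
    by (rule per[rule_format, OF _ _ that]) (use bV in \<open>auto simp: E_def d_def\<close>)
  then have "card {u. b R (u + int P) \<noteq> b R u} \<le> N1 * nat (2 * w + 1)"
    by (rule card_break_points[OF E Pw(2)])
  then have "NC (c R) (n R) < N2"
    using \<delta> c bB fz by (intro N2[rule_format]) (auto simp: b_def)
  moreover have "N2 \<le> R" using seq_suble[OF r(1), of N] by (simp add: R_def N_def)
  ultimately show False using large[of R] by linarith
qed

section \<open>From zero counts in a period to the limit statement\<close>

lemma few_zeros_of_NZ:
  assumes "NZ s (cos_poly c n) \<le> enat k"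
  shows "few_zeros k (cos_poly c n)"
proof -
  let ?T = "cos_poly c n"
  define Z where "Z = {t \<in> {s..<s + 2 * pi}. ?T t = 0}"
  have "finite Z" using assms by (auto simp: NZ_def Let_def Z_def split: if_splits)
  then have "(\<Sum>t\<in>Z. zero_multiplicity ?T t) \<le> enat k" using assms by (simp add: NZ_def Let_def Z_def)
  \<comment> \<open>At a zero the derivative of order 0 vanishes, so the multiplicity is at least 1,
    also when it is infinite.\<close>
  moreover have "(\<Sum>t\<in>Z. 1) \<le> (\<Sum>t\<in>Z. zero_multiplicity ?T t)"
  proof (rule sum_mono)
    fix t assume "t \<in> Z"
    then have "1 \<le> m" if "(deriv ^^ m) ?T t \<noteq> 0" for m
      using that by (cases m) (auto simp: Z_def)
    then show "1 \<le> zero_multiplicity ?T t"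
      unfolding zero_multiplicity_def by (intro Inf_greatest) (auto simp: one_enat_def)
  qed
  moreover have "(\<Sum>t\<in>Z. 1) = enat (card Z)" by (simp add: of_nat_eq_enat)
  ultimately have "enat (card Z) \<le> enat k" by (metis order_trans)
  then have "card Z \<le> k" by simp
  \<comment> \<open>Translation by a multiple of \<open>2 * pi\<close> into the period starting at
    \<open>s\<close>; points of \<open>(0, pi)\<close> are too close together to be
    identified.\<close>
  define \<psi> where "\<psi> t = t - 2 * pi * of_int \<lfloor>(t - s) / (2 * pi)\<rfloor>" for t
  define Y where "Y = {t\<in>{0<..<pi}. ?T t = 0}"
  have "inj_on \<psi> Y"
  proof (rule inj_onI)
    fix x y assume xy: "x \<in> Y" "y \<in> Y" "\<psi> x = \<psi> y"
    define m where "m = \<lfloor>(x - s) / (2 * pi)\<rfloor> - \<lfloor>(y - s) / (2 * pi)\<rfloor>"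
    have m: "x - y = 2 * pi * of_int m" using xy(3) by (simp add: \<psi>_def m_def algebra_simps)
    have "\<bar>x - y\<bar> < pi" using xy(1,2) by (auto simp: Y_def)
    then have "2 * pi * \<bar>of_int m\<bar> < 2 * pi * (1 :: real)" using m by (simp add: abs_mult)
    then have "\<bar>of_int m\<bar> < (1 :: real)" using pi_gt_zero by (simp only: mult_less_cancel_left_pos)
    then have "m = 0" by linarith
    then show "x = y" using m by simp
  qed
  moreover have "\<psi> ` Y \<subseteq> Z"
  proof
    fix x assume "x \<in> \<psi> ` Y"
    then obtain t where t: "t \<in> Y" "x = \<psi> t" by blast
    define m where "m = \<lfloor>(t - s) / (2 * pi)\<rfloor>"
    have "of_int m \<le> (t - s) / (2 * pi)" "(t - s) / (2 * pi) < of_int m + 1"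
      unfolding m_def by linarith+
    moreover have "x = t - 2 * pi * of_int m" by (simp only: t(2) \<psi>_def m_def)
    ultimately have "s \<le> x" "x < s + 2 * pi"
      using pi_gt_zero by (simp_all add: field_simps)
    moreover have "?T x = 0" using t by (simp add: \<psi>_def cos_poly_periodic Y_def)
    ultimately show "x \<in> Z" by (simp add: Z_def)
  qed
  ultimately have "finite Y" "card Y \<le> card Z"
    using \<open>finite Z\<close> inj_on_finite card_inj_on_le by blast+
  then show ?thesis using \<open>card Z \<le> k\<close> by (simp add: few_zeros_def Y_def)
qed

theorem corollary2p7:
  fixes a :: "nat \<Rightarrow> nat \<Rightarrow> real" and s :: real
  assumes "finite {a j n | j n. j \<le> n \<and> 1 \<le> n}"
    and "{a j n | j n. j \<le> n \<and> 1 \<le> n} \<subseteq> {0..}"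
    and "filterlim (\<lambda>n. NC (\<lambda>j. a j n) n) at_top sequentially"
  shows "(\<lambda>n. NZ s (cos_poly (\<lambda>j. a j n) n)) \<longlonglongrightarrow> \<infinity>"
proof (rule order_tendstoI)
  fix l :: enat assume "l < \<infinity>"
  then obtain k where l: "l = enat k" by (cases l) auto
  obtain N where N: "\<And>c n. (\<And>j. j \<le> n \<Longrightarrow> c j \<in> {a j n | j n. j \<le> n \<and> 1 \<le> n}) \<Longrightarrow>
      few_zeros k (cos_poly c n) \<Longrightarrow> NC c n < N"
    using NC_bounded_of_few_zeros[OF assms(1,2), of k] by blast
  \<comment> \<open>The set of coefficients covers only indices \<open>n\<close> from 1 on, so
    \<open>n = 0\<close> is excluded here.\<close>
  have "\<forall>\<^sub>F n in sequentially. N \<le> NC (\<lambda>j. a j n) n" "\<forall>\<^sub>F n in sequentially. 1 \<le> n"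
    using assms(3) eventually_ge_at_top by (auto simp: filterlim_at_top)
  then show "\<forall>\<^sub>F n in sequentially. l < NZ s (cos_poly (\<lambda>j. a j n) n)"
  proof eventually_elim
    case (elim n)
    show ?case
    proof (rule ccontr)
      assume "\<not> ?thesis"
      then have "few_zeros k (cos_poly (\<lambda>j. a j n) n)" by (intro few_zeros_of_NZ[of s]) (simp add: l)
      then have "NC (\<lambda>j. a j n) n < N" using elim by (intro N) auto
      then show False using elim by simp
    qed
  qed
qed (simp add: not_less)

end
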